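(* Let $f$ be an admissible polynomial subordinate to a triple $\mathfrak D=(D_1,D_2,D_3)$ of pairwise disjoint open discs in $\mathbb{CP}(1)$, and consider the sequence $\{f^{(n)}\}_{n=0}^\infty$ of elements of $\mathfrak P_6$ defined by $$f^{(0)}=f,\qquad f^{(n+1)}=H_{\mathfrak D}\bigl(f^{(n)}\bigr).$$ Then the sequence $f^{(n)}$ converges quadratically (in the finite-dimensional space $\mathfrak P_6$) to a polynomial that has three double roots, one in each disc $D_j$, $j=1,2,3$.
   Context: $\mathfrak P_k$ is the space of complex polynomials (in $x$) of degree $\le k$; for a polynomial $f$, $f_j$ is the coefficient of $x^j$. Roots are counted with multiplicity in $\mathbb{CP}(1)=\mathbb C\cup\{\infty\}$: a non-zero $p\in\mathfrak P_2$ has $\infty$ as a root of multiplicity $2-\deg p$, and a non-zero $f\in\mathfrak P_6$ has $\infty$ as a root of multiplicity $6-\deg f$. A polynomial $f\in\mathfrak P_6$ is admissible if it has no multiple roots and $\deg f\in\{5,6\}$. An open disc in $\mathbb{CP}(1)$ is the image of the open unit disc of $\mathbb C$ under a Möbius transformation. A non-zero $f\in\mathfrak P_6$ is subordinate to a triple $\mathfrak D=(D_1,D_2,D_3)$ of pairwise disjoint open discs if each $D_j$ contains exactly two roots of $f$, counted with multiplicity. For $p,q,r\in\mathfrak P_2$: $[p,q]=p'q-pq'$ and $\Delta(p,q,r)=\det\begin{pmatrix} p_0 & q_0 & r_0 \\ p_1 & q_1 & r_1 \\ p_2 & q_2 & r_2 \end{pmatrix}$. If $f$ is subordinate to $\mathfrak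 D$, write $f=p_1p_2p_3$ with $p_j\in\mathfrak P_2$ having both roots in $D_j$, and put $$H_{\mathfrak D}(f)=\frac{1}{4\Delta(p_1,p_2,p_3)}[p_2,p_3][p_3,p_1][p_1,p_2].$$ This is independent of the choice of the $p_j$; moreover $\Delta(p_1,p_2,p_3)\ne0$, $H_{\mathfrak D}(f)$ is again subordinate to $\mathfrak D$, and it is admissible if $f$ is. A sequence $\{a_n\}$ with limit $a$ converges quadratically if there are constants $C,D>0$ with $|a_n-a|\le C\exp(-D2^n)$ for all $n$ (with any norm in place of $|\cdot|$ for sequences in a finite-dimensional space). *)

theory Defs
  imports "HOL-Analysis.Analysis" "HOL-Computational_Algebra.Polynomial"
begin

text \<open>The space of complex polynomials of degree at most \<open>k\<close>.\<close>

definition polys_upto :: "nat \<Rightarrow> complex poly set" where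
  "polys_upto k = {p. degree p \<le> k}"

text \<open>The complex projective line; \<^term>\<open>None\<close> is the point at infinity.\<close>

type_synonym cp1 = "complex option"

text \<open>The multiplicity of a point of the projective line as a root of a non-zero \<open>p\<close>, regarded
  as an element of \<open>polys_upto k\<close>. It is only meaningful for \<open>p \<noteq> 0\<close>, so this is required
  explicitly wherever the function is used.\<close>

definition root_mult :: "nat \<Rightarrow> complex poly \<Rightarrow> cp1 \<Rightarrow> nat" where
  "root_mult k p z = (case z of None \<Rightarrow> k - degree p | Some a \<Rightarrow> order a p)"

definition num_roots_in :: "nat \<Rightarrow> complex poly \<Rightarrow> cp1 set \<Rightarrow> nat" where
  "num_roots_in k p S = (\<Sum>z\<in>{z\<in>S. root_mult k p z > 0}. root_mult k p z)"

definition admissible :: "complex poly \<Rightarrow> bool" where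
  "admissible f \<longleftrightarrow>
     f \<noteq> 0 \<and> (\<forall>z. root_mult 6 f z \<le> 1) \<and> degree f \<in> {5, 6}"

text \<open>The map \<open>z \<mapsto> (a z + b) / (c z + d)\<close>, a Moebius transformation when \<open>a d - b c \<noteq> 0\<close>.\<close>

definition moebius :: "complex \<Rightarrow> complex \<Rightarrow> complex \<Rightarrow> complex \<Rightarrow> cp1 \<Rightarrow> cp1" where
  "moebius a b c d z =
     (case z of
        None \<Rightarrow> if c = 0 then None else Some (a / c)
      | Some w \<Rightarrow> if c * w + d = 0 then None else Some ((a * w + b) / (c * w + d)))"

definition open_disc :: "cp1 set \<Rightarrow> bool" where
  "open_disc S \<longleftrightarrow>
     (\<exists>a b c d. a * d - b * c \<noteq> 0 \<and> S = moebius a b c d ` Some ` ball 0 1)"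

type_synonym cp1_triple = "cp1 set \<times> cp1 set \<times> cp1 set"

definition disjoint_open_discs :: "cp1_triple \<Rightarrow> bool" where
  "disjoint_open_discs = (\<lambda>(D1, D2, D3).
     open_disc D1 \<and> open_disc D2 \<and> open_disc D3 \<and>
     D1 \<inter> D2 = {} \<and> D1 \<inter> D3 = {} \<and> D2 \<inter> D3 = {})"

definition subordinate :: "complex poly \<Rightarrow> cp1_triple \<Rightarrow> bool" where
  "subordinate f = (\<lambda>(D1, D2, D3).
     f \<noteq> 0 \<and> f \<in> polys_upto 6 \<and>
     num_roots_in 6 f D1 = 2 \<and> num_roots_in 6 f D2 = 2 \<and> num_roots_in 6 f D3 = 2)"

definition bracket :: "complex poly \<Rightarrow> complex poly \<Rightarrow> complex poly" where
  "bracket p q = pderiv p * q - p * pderiv q"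

definition Delta :: "complex poly \<Rightarrow> complex poly \<Rightarrow> complex poly \<Rightarrow> complex" where
  "Delta p q r = det (vector
     [vector [coeff p 0, coeff q 0, coeff r 0],
      vector [coeff p 1, coeff q 1, coeff r 1],
      vector [coeff p 2, coeff q 2, coeff r 2]] :: complex ^ 3 ^ 3)"

definition both_roots_in :: "complex poly \<Rightarrow> cp1 set \<Rightarrow> bool" where
  "both_roots_in p S \<longleftrightarrow>
     p \<noteq> 0 \<and> p \<in> polys_upto 2 \<and> (\<forall>z. root_mult 2 p z > 0 \<longrightarrow> z \<in> S)"

definition factorization ::
  "cp1_triple \<Rightarrow> complex poly \<Rightarrow> complex poly \<times> complex poly \<times> complex poly \<Rightarrow> bool" where
  "factorization = (\<lambda>(D1, D2, D3) f (p1, p2, p3).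
     f = p1 * p2 * p3 \<and> both_roots_in p1 D1 \<and> both_roots_in p2 D2 \<and> both_roots_in p3 D3)"

text \<open>If \<open>f\<close> is subordinate to a triple \<open>D\<close> of disjoint open discs, the factors are determined up
  to scalars with product 1, so the value below does not depend on the chosen factorization.\<close>

definition H :: "cp1_triple \<Rightarrow> complex poly \<Rightarrow> complex poly" where
  "H D f = (case (SOME ps. factorization D f ps) of (p1, p2, p3) \<Rightarrow>
     smult (1 / (4 * Delta p1 p2 p3)) (bracket p2 p3 * bracket p3 p1 * bracket p1 p2))"

definition norm_on_polys :: "nat \<Rightarrow> (complex poly \<Rightarrow> real) \<Rightarrow> bool" where
  "norm_on_polys k N \<longleftrightarrow>
     (\<forall>p\<in>polys_upto k. N p \<ge> 0 \<and> (N p = 0 \<longleftrightarrow> p = 0)) \<and>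
     (\<forall>c. \<forall>p\<in>polys_upto k. N (smult c p) = cmod c * N p) \<and>
     (\<forall>p\<in>polys_upto k. \<forall>q\<in>polys_upto k. N (p + q) \<le> N p + N q)"

definition converges_quadratically_to ::
  "('a::ab_group_add \<Rightarrow> real) \<Rightarrow> (nat \<Rightarrow> 'a) \<Rightarrow> 'a \<Rightarrow> bool" where
  "converges_quadratically_to N a l \<longleftrightarrow>
     (\<lambda>n. N (a n - l)) \<longlonglongrightarrow> 0 \<and>
     (\<exists>C>0. \<exists>D>0. \<forall>n. N (a n - l) \<le> C * exp (- D * 2 ^ n))"

definition double_root_in_each :: "complex poly \<Rightarrow> cp1_triple \<Rightarrow> bool" where
  "double_root_in_each g = (\<lambda>(D1, D2, D3).
     g \<noteq> 0 \<and> g \<in> polys_upto 6 \<and>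
     (\<exists>z1\<in>D1. \<exists>z2\<in>D2. \<exists>z3\<in>D3.
        z1 \<noteq> z2 \<and> z1 \<noteq> z3 \<and> z2 \<noteq> z3 \<and> {z. root_mult 6 g z = 2} = {z1, z2, z3}))"

end

(* Each disc D_j is parametrised by the unit disc. The roots of [p_1, p_2] are harmonically
   conjugate to the roots of p_1 and to those of p_2, and one of them lies in each of D_1, D_2. If
   z, w are the roots of p_j, its two successors u, u' in D_j are thus harmonic conjugates, with
   respect to z, w, of points outside D_j. For the pseudo-hyperbolic distance rho of D_j this forces
   rho(z, u) <= rho(z, w) and rho(u, u') <= rho(z, w)^2, while every closed disc |x| <= r with r < 1
   containing z, w also contains u, u'. So the two roots in D_j converge quadratically to a common
   limit inside D_j. The map H fixes every product of three squares with roots in distinct discs,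
   hence the scalar factors of successive iterates have quotients tending to 1 quadratically, and
   they converge to a non-zero limit. *)

theory Submission
  imports Defs "HOL-Computational_Algebra.Fundamental_Theorem_Algebra"
begin

section \<open>Harmonic conjugates in the unit disc\<close>

text \<open>The two successors in D_1 come from different brackets, \<open>[p_1, p_2]\<close> and
  \<open>[p_3, p_1]\<close>, and their conjugate partners lie in D_2 and D_3. Of these partners only
  one fact is kept: they lie outside D_1. This decouples the discs. Each becomes a problem about one
  pair in the unit disc and two arbitrary exterior points, with estimates uniform in the latter.
  Three difficulties shape the rest. A disc may contain \<infinity>, hence homogeneous linear forms
  and degree bounds in place of degrees. The roots in a disc are unordered, so sequences of roots
  have to be chosen. And \<open>H\<close> is homogeneous of degree one, so the roots say nothing
  about the scalar factor; its quotients are read off from a coefficient that does not vanish in the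
  limit.\<close>

text \<open>The cross ratio \<open>(z, w; u, 1/\<nu>)\<close> is \<open>-1\<close>. The fourth point enters through its inverse
  \<open>\<nu>\<close>, so that \<open>norm \<nu> \<le> 1\<close> describes the exterior of the open unit disc with \<open>\<infinity>\<close> included.\<close>

definition harm :: "complex \<Rightarrow> complex \<Rightarrow> complex \<Rightarrow> complex \<Rightarrow> bool" where
  "harm z w \<nu> u \<longleftrightarrow> (u - z) * (1 - \<nu> * w) + (u - w) * (1 - \<nu> * z) = 0"

lemma one_minus_mult_nonzero:
  fixes a b :: complex
  assumes "norm a \<le> 1" "norm b < 1"
  shows "1 - a * b \<noteq> 0"
proof
  assume "1 - a * b = 0"
  then have "norm (a * b) = 1" by (metis eq_iff_diff_eq_0 norm_one)
  moreover have "norm a * norm b \<le> norm b"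
    using assms(1) by (simp add: mult_left_le_one_le)
  ultimately show False using assms(2) by (simp add: norm_mult)
qed

lemma complex_parallelogram:
  fixes a b :: complex
  shows "(norm (a + b))\<^sup>2 + (norm (a - b))\<^sup>2 = 2 * (norm a)\<^sup>2 + 2 * (norm b)\<^sup>2"
  unfolding cmod_power2 by (simp add: power2_eq_square algebra_simps)

lemma harm_norm_le:
  assumes h: "harm z w \<nu> u" and \<nu>: "norm \<nu> \<le> 1"
    and z: "norm z \<le> r" and w: "norm w \<le> r" and r: "r < 1"
  shows "norm u \<le> r"
proof -
  have r0: "0 \<le> r" using norm_ge_zero[of z] z by linarith
  have nz: "1 - \<nu> * z \<noteq> 0" "1 - \<nu> * w \<noteq> 0"
    by (intro one_minus_mult_nonzero[OF \<nu>] order_le_less_trans[OF _ r] z w)+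
  text \<open>The values of \<open>x \<mapsto> (u - x) / (1 - \<nu> x)\<close> at \<open>z\<close> and \<open>w\<close> are \<open>\<zeta>\<close> and \<open>-\<zeta>\<close>; the
    bounds on \<open>z\<close> and \<open>w\<close> become quadratic in \<open>\<zeta>\<close>, and their sum has no term linear in \<open>\<zeta>\<close>.\<close>
  define \<zeta> where "\<zeta> = (u - z) / (1 - \<nu> * z)"
  have \<zeta>': "- \<zeta> = (u - w) / (1 - \<nu> * w)"
    using h nz unfolding harm_def \<zeta>_def by (simp add: field_simps)
  have "u - \<zeta> = z * (1 - \<nu> * \<zeta>)"
    using nz unfolding \<zeta>_def by (simp add: field_simps)
  then have "norm (u - \<zeta>) \<le> r * norm (1 - \<nu> * \<zeta>)"
    using z by (simp add: norm_mult mult_right_mono)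
  then have 1: "(norm (u - \<zeta>))\<^sup>2 \<le> r\<^sup>2 * (norm (1 - \<nu> * \<zeta>))\<^sup>2"
    by (metis norm_ge_zero power_mono power_mult_distrib)
  have "u + \<zeta> = w * (1 + \<nu> * \<zeta>)"
  proof -
    have "(u - w) = - \<zeta> * (1 - \<nu> * w)" using nz \<zeta>' by simp
    then show ?thesis by (simp add: algebra_simps)
  qed
  then have "norm (u + \<zeta>) \<le> r * norm (1 + \<nu> * \<zeta>)"
    using w by (simp add: norm_mult mult_right_mono)
  then have 2: "(norm (u + \<zeta>))\<^sup>2 \<le> r\<^sup>2 * (norm (1 + \<nu> * \<zeta>))\<^sup>2"
    by (metis norm_ge_zero power_mono power_mult_distrib)
  have "2 * (norm u)\<^sup>2 + 2 * (norm \<zeta>)\<^sup>2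
      \<le> r\<^sup>2 * ((norm (1 + \<nu> * \<zeta>))\<^sup>2 + (norm (1 - \<nu> * \<zeta>))\<^sup>2)"
    using complex_parallelogram[of u \<zeta>] 1 2 unfolding distrib_left[of "r\<^sup>2"] by linarith
  then have "2 * (norm u)\<^sup>2 + 2 * (norm \<zeta>)\<^sup>2 \<le> r\<^sup>2 * (2 + 2 * (norm (\<nu> * \<zeta>))\<^sup>2)"
    unfolding complex_parallelogram[of 1 "\<nu> * \<zeta>"] by simp
  moreover have "(norm (\<nu> * \<zeta>))\<^sup>2 \<le> (norm \<zeta>)\<^sup>2"
    using \<nu> by (intro power_mono) (auto simp: norm_mult mult_left_le_one_le)
  then have "r\<^sup>2 * (norm (\<nu> * \<zeta>))\<^sup>2 \<le> 1 * (norm \<zeta>)\<^sup>2"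
    using r r0 by (intro mult_mono) (auto simp: power_le_one)
  ultimately have "(norm u)\<^sup>2 \<le> r\<^sup>2" by (simp add: algebra_simps)
  then show ?thesis using r0 by (rule power2_le_imp_le)
qed

text \<open>The parallelogram law removes the terms linear in \<open>\<zeta>\<close>: adding the two
  bounds gives \<open>1 + |\<zeta>|^2 \<le> |u|^2 + |v \<zeta>|^2\<close>, impossible for points of
  the open disc. Here \<open>u\<close>, \<open>v\<close> are harmonic conjugates with respect to the
  exterior points \<open>1/\<alpha>\<close>, \<open>1/\<beta>\<close>; the lemma will place one root
  of a bracket outside the disc.\<close>

lemma harmonic_pair_not_inside:
  fixes \<alpha> \<beta> u v :: complex
  assumes ab: "norm \<alpha> \<le> 1" "norm \<beta> \<le> 1" and uv: "norm u < 1" "norm v < 1"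
  shows "(1 - \<alpha> * u) * (1 - \<beta> * v) + (1 - \<beta> * u) * (1 - \<alpha> * v) \<noteq> 0"
proof
  assume h: "(1 - \<alpha> * u) * (1 - \<beta> * v) + (1 - \<beta> * u) * (1 - \<alpha> * v) = 0"
  have nz: "1 - \<alpha> * v \<noteq> 0" "1 - \<beta> * v \<noteq> 0"
    using one_minus_mult_nonzero ab uv by blast+
  define \<zeta> where "\<zeta> = (1 - \<alpha> * u) / (1 - \<alpha> * v)"
  have \<zeta>': "- \<zeta> = (1 - \<beta> * u) / (1 - \<beta> * v)"
    using h nz unfolding \<zeta>_def by (simp add: field_simps eq_neg_iff_add_eq_0)
  have "\<alpha> * (u - v * \<zeta>) = 1 - \<zeta>"
    using nz unfolding \<zeta>_def by (simp add: field_simps)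
  then have "norm (1 - \<zeta>) \<le> norm (u - v * \<zeta>)"
    using ab by (metis mult_left_le_one_le norm_ge_zero norm_mult)
  then have 1: "(norm (1 - \<zeta>))\<^sup>2 \<le> (norm (u - v * \<zeta>))\<^sup>2" by (simp add: power_mono)
  have "\<beta> * (u + v * \<zeta>) = 1 + \<zeta>"
  proof -
    have "1 - \<beta> * u = - \<zeta> * (1 - \<beta> * v)" using nz \<zeta>' by simp
    then show ?thesis by (simp add: algebra_simps)
  qed
  then have "norm (1 + \<zeta>) \<le> norm (u + v * \<zeta>)"
    using ab by (metis mult_left_le_one_le norm_ge_zero norm_mult)
  then have 2: "(norm (1 + \<zeta>))\<^sup>2 \<le> (norm (u + v * \<zeta>))\<^sup>2" by (simp add: power_mono)
  have "1 + (norm \<zeta>)\<^sup>2 \<le> (norm u)\<^sup>2 + (norm (v * \<zeta>))\<^sup>2"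
    using complex_parallelogram[of u "v * \<zeta>"] complex_parallelogram[of 1 \<zeta>] 1 2
    unfolding norm_one one_power2 by linarith
  moreover have "(norm (v * \<zeta>))\<^sup>2 \<le> (norm \<zeta>)\<^sup>2"
    using uv by (intro power_mono) (auto simp: norm_mult mult_left_le_one_le)
  moreover have "(norm u)\<^sup>2 < 1" using uv by (simp add: abs_square_less_1)
  ultimately show False by linarith
qed

section \<open>The pseudo-hyperbolic distance and its contraction\<close>

definition pseudo_hdist :: "complex \<Rightarrow> complex \<Rightarrow> real" where
  "pseudo_hdist z w = norm (z - w) / norm (1 - cnj z * w)"

lemma norm_one_minus_cnj_mult:
  "(norm (1 - cnj z * w))\<^sup>2 = (norm (z - w))\<^sup>2 + (1 - (norm z)\<^sup>2) * (1 - (norm w)\<^sup>2)"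
  unfolding cmod_power2 by (simp add: power2_eq_square algebra_simps)

lemma pseudo_hdist_nonneg: "0 \<le> pseudo_hdist z w"
  by (simp add: pseudo_hdist_def)

lemma pseudo_hdist_less_1:
  assumes "norm z < 1" "norm w < 1"
  shows "pseudo_hdist z w < 1"
proof -
  have "0 < (1 - (norm z)\<^sup>2) * (1 - (norm w)\<^sup>2)"
    using assms by (intro mult_pos_pos) (auto simp: abs_square_less_1)
  then have "(norm (z - w))\<^sup>2 < (norm (1 - cnj z * w))\<^sup>2"
    unfolding norm_one_minus_cnj_mult by simp
  then have "norm (z - w) < norm (1 - cnj z * w)"
    by (rule power_less_imp_less_base) simp
  then show ?thesis unfolding pseudo_hdist_def
    by (metis divide_less_eq_1_pos norm_ge_zero order_le_less_trans)
qed

lemma norm_diff_le_pseudo_hdist: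
  assumes "norm z < 1" "norm w < 1"
  shows "norm (z - w) \<le> 2 * pseudo_hdist z w"
proof -
  have nz: "1 - cnj z * w \<noteq> 0" using assms by (intro one_minus_mult_nonzero) auto
  have "norm (1 - cnj z * w) \<le> norm (1::complex) + norm (cnj z * w)" by (rule norm_triangle_ineq4)
  also have "norm (cnj z * w) \<le> 1"
    using assms by (simp add: norm_mult mult_le_one)
  finally have le: "norm (1 - cnj z * w) \<le> 2" by simp
  have "norm (z - w) = norm (1 - cnj z * w) * pseudo_hdist z w" using nz by (simp add: pseudo_hdist_def)
  also have "\<dots> \<le> 2 * pseudo_hdist z w" using le pseudo_hdist_nonneg by (rule mult_right_mono)
  finally show ?thesis .
qed

lemma pseudo_hdist_moebius:
  assumes z: "norm z < 1" and uv: "norm u < 1" "norm v < 1"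
  shows "pseudo_hdist ((u - z) / (1 - cnj z * u)) ((v - z) / (1 - cnj z * v)) = pseudo_hdist u v"
proof -
  have nz: "1 - cnj z * u \<noteq> 0" "1 - cnj z * v \<noteq> 0" "1 - cnj z * z \<noteq> 0" "1 - z * cnj u \<noteq> 0"
    using z uv one_minus_mult_nonzero[of "cnj z"] one_minus_mult_nonzero[of z] by simp_all
  have 1: "(u - z) / (1 - cnj z * u) - (v - z) / (1 - cnj z * v) =
      (u - v) * (1 - cnj z * z) / ((1 - cnj z * u) * (1 - cnj z * v))"
    using nz by (simp add: divide_simps) (simp add: algebra_simps)
  have 2: "1 - cnj ((u - z) / (1 - cnj z * u)) * ((v - z) / (1 - cnj z * v)) =
      (1 - cnj u * v) * (1 - cnj z * z) / ((1 - z * cnj u) * (1 - cnj z * v))"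
    using nz by (simp add: divide_simps) (simp add: algebra_simps)
  have 3: "norm (1 - z * cnj u) = norm (1 - cnj z * u)"
    by (metis complex_cnj_cnj complex_cnj_diff complex_cnj_mult complex_cnj_one complex_mod_cnj)
  show ?thesis unfolding pseudo_hdist_def 1 2 using nz 3 by (simp add: norm_mult norm_divide)
qed

text \<open>The right side minus the left side is \<open>(2 - \<rho>) * (\<rho>^2 - |N|^2)\<close>.
  The lower bound has the form constant plus square, so that Cauchy--Schwarz applies to a product of
  two such factors.\<close>

lemma contraction_aux1:
  fixes \<rho> :: real and N :: complex
  assumes \<rho>: "0 < \<rho>" "\<rho> < 1" and N: "norm N \<le> \<rho>"
  shows "4 * \<rho> * (1 - \<rho>) + 2 * (norm (of_real \<rho> - N))\<^sup>2 \<le> \<rho> * ((norm (2 - N))\<^sup>2 - \<rho>\<^sup>2)"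
proof -
  define n where "n = (norm N)\<^sup>2"
  have n: "n \<le> \<rho>\<^sup>2" using N unfolding n_def by (simp add: power_mono)
  have a: "(norm (2 - N))\<^sup>2 = 4 - 4 * Re N + n" 
    unfolding n_def cmod_power2 by (simp add: power2_eq_square algebra_simps)
  have b: "(norm (of_real \<rho> - N))\<^sup>2 = \<rho>\<^sup>2 - 2 * \<rho> * Re N + n"
    unfolding n_def cmod_power2 by (simp add: power2_eq_square algebra_simps)
  have "0 \<le> (2 - \<rho>) * (\<rho>\<^sup>2 - n)" using n \<rho> by simp
  then show ?thesis unfolding a b by (simp add: algebra_simps power2_eq_square)
qed

text \<open>For \<open>u = r / (2 - N)\<close>, \<open>u' = r / (2 - N')\<close> and
  \<open>\<rho> = |r|\<close>, this is the bound \<open>\<rho>^2\<close> on the distance of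
  \<open>u\<close> and \<open>u'\<close>, squared and cleared of denominators. The main argument
  needs \<open>(1 + \<rho>) * (1 + \<rho>^2) \<le> 8 * \<rho>\<close>, which fails for small
  \<open>\<rho>\<close>; there crude estimates of each factor are enough.\<close>

lemma contraction_aux2:
  fixes \<rho> :: real and N N' :: complex
  assumes \<rho>: "0 \<le> \<rho>" "\<rho> < 1" and N: "norm N \<le> \<rho>" "norm N' \<le> \<rho>"
  shows "(1 - \<rho>^4) * (norm (N - N'))\<^sup>2 \<le> 
     \<rho>\<^sup>2 * (((norm (2 - N))\<^sup>2 - \<rho>\<^sup>2) * ((norm (2 - N'))\<^sup>2 - \<rho>\<^sup>2))"
proof (cases "\<rho> \<le> 1/4")
  case True
  have A: "0 \<le> 4 * (1 - \<rho>) \<and> 4 * (1 - \<rho>) \<le> (norm (2 - x))\<^sup>2 - \<rho>\<^sup>2" if "norm x \<le> \<rho>" for x :: complex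
  proof -
    have "2 - \<rho> \<le> norm (2 - x)" using norm_triangle_ineq2[of 2 x] that by simp
    then have "(2 - \<rho>)\<^sup>2 \<le> (norm (2 - x))\<^sup>2" using \<rho> by (intro power_mono) auto
    then show ?thesis using \<rho> by (simp add: power2_eq_square algebra_simps)
  qed
  have "norm (N - N') \<le> 2 * \<rho>" using norm_triangle_ineq4[of N N'] N by simp
  then have "(norm (N - N'))\<^sup>2 \<le> (2 * \<rho>)\<^sup>2" by (rule power_mono) simp
  then have "(1 - \<rho>^4) * (norm (N - N'))\<^sup>2 \<le> 1 * (2 * \<rho>)\<^sup>2"
    using \<rho> by (intro mult_mono) (auto simp: power_le_one)
  also have "\<dots> = \<rho>\<^sup>2 * 4" by (simp add: power2_eq_square)
  also have "\<dots> \<le> \<rho>\<^sup>2 * ((4 * (1 - \<rho>)) * (4 * (1 - \<rho>)))"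
  proof (rule mult_left_mono)
    have "3 * 3 \<le> (4 * (1 - \<rho>)) * (4 * (1 - \<rho>))" using True by (intro mult_mono) auto
    then show "4 \<le> (4 * (1 - \<rho>)) * (4 * (1 - \<rho>))" by linarith
  qed simp
  also have "\<dots> \<le> \<rho>\<^sup>2 * (((norm (2 - N))\<^sup>2 - \<rho>\<^sup>2) * ((norm (2 - N'))\<^sup>2 - \<rho>\<^sup>2))"
    using A[OF N(1)] A[OF N(2)] by (intro mult_left_mono mult_mono) (auto simp del: power_mono_iff)
  finally show ?thesis .
next
  case False
  text \<open>Cauchy--Schwarz: \<open>2 a (d + d')\<^sup>2 \<le> (a + 2 d\<^sup>2) (a + 2 d'\<^sup>2)\<close>.\<close>
  define d d' where "d = norm (of_real \<rho> - N)" and "d' = norm (of_real \<rho> - N')"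
  define a where "a = 4 * \<rho> * (1 - \<rho>)"
  have a0: "0 \<le> a" unfolding a_def using \<rho> by simp
  have "norm (N - N') \<le> d + d'"
    unfolding d_def d'_def by (metis norm_minus_commute norm_triangle_ineq4 diff_diff_eq2 diff_add_cancel)
  then have 1: "(norm (N - N'))\<^sup>2 \<le> (d + d')\<^sup>2" by (rule power_mono) simp
  have "1 - \<rho>^4 \<le> 2 * a"
  proof -
    have "1 - \<rho>^4 = (1 - \<rho>) * (1 + \<rho>) * (1 + \<rho>\<^sup>2)"
      by (simp add: algebra_simps power2_eq_square power4_eq_xxxx)
    also have "\<dots> \<le> (1 - \<rho>) * (8 * \<rho>)"
    proof -
      have "(1 + \<rho>) * (1 + \<rho>\<^sup>2) \<le> (1 + \<rho>) * (1 + \<rho>)"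
        using \<rho> by (intro mult_left_mono) (auto simp: power2_eq_square mult_left_le)
      also have "\<dots> \<le> 8 * \<rho>"
      proof -
        have "0 \<le> (\<rho> - 1/4) * (1 - \<rho>)" using False \<rho> by simp
        also have "(\<rho> - 1/4) * (1 - \<rho>) = \<rho> * 5/4 - \<rho> * \<rho> - 1/4" by (simp add: field_simps)
        finally show ?thesis using False by (simp add: algebra_simps)
      qed
      finally have "(1 + \<rho>) * (1 + \<rho>\<^sup>2) \<le> 8 * \<rho>" .
      then show ?thesis using \<rho> by (simp add: mult.assoc)
    qed
    finally show ?thesis by (simp add: a_def algebra_simps)
  qed
  then have "(1 - \<rho>^4) * (norm (N - N'))\<^sup>2 \<le> 2 * a * (d + d')\<^sup>2"
    using 1 a0 by (intro mult_mono) auto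
  also have "\<dots> \<le> (a + 2 * d\<^sup>2) * (a + 2 * d'\<^sup>2)"
  proof -
    have "0 \<le> (a - 2 * d * d')\<^sup>2" by simp
    then show ?thesis by (simp add: algebra_simps power2_eq_square)
  qed
  also have "\<dots> \<le> (\<rho> * ((norm (2 - N))\<^sup>2 - \<rho>\<^sup>2)) * (\<rho> * ((norm (2 - N'))\<^sup>2 - \<rho>\<^sup>2))"
  proof -
    have *: "a + 2 * d\<^sup>2 \<le> \<rho> * ((norm (2 - N))\<^sup>2 - \<rho>\<^sup>2)" "a + 2 * d'\<^sup>2 \<le> \<rho> * ((norm (2 - N'))\<^sup>2 - \<rho>\<^sup>2)"
      unfolding a_def d_def d'_def using contraction_aux1 False \<rho> N by auto
    have "0 \<le> a + 2 * d\<^sup>2" "0 \<le> a + 2 * d'\<^sup>2" using a0 by auto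
    then show ?thesis by (intro mult_mono[OF * order_trans[OF _ *(1)]])
  qed
  also have "\<dots> = \<rho>\<^sup>2 * (((norm (2 - N))\<^sup>2 - \<rho>\<^sup>2) * ((norm (2 - N'))\<^sup>2 - \<rho>\<^sup>2))"
    by (simp only: power2_eq_square[of \<rho>] mult_ac)
  finally show ?thesis .
qed

text \<open>The contraction for \<open>z = 0\<close>, \<open>w = r\<close>: there
  \<open>harm\<close> reads \<open>u * (2 - \<nu> * r) = r\<close>, so \<open>u\<close> is explicit,
  and the exterior point enters only through \<open>N = \<nu> * r\<close>, which ranges over the
  disc of radius \<open>|r|\<close>.\<close>

lemma pseudo_hdist_harm_origin:
  assumes r: "norm r < 1" and \<nu>: "norm \<nu> \<le> 1" "norm \<nu>' \<le> 1"
    and u: "u * (2 - \<nu> * r) = r" and u': "u' * (2 - \<nu>' * r) = r"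
  shows "norm u \<le> norm r" "pseudo_hdist u u' \<le> (norm r)\<^sup>2"
proof -
  define N N' where "N = \<nu> * r" and "N' = \<nu>' * r"
  have N: "norm N \<le> norm r" "norm N' \<le> norm r"
    using \<nu> by (simp_all add: N_def N'_def norm_mult mult_left_le_one_le)
  have ge: "1 \<le> norm (2 - x)" if "norm x \<le> norm r" for x :: complex
    using norm_triangle_ineq2[of 2 x] that r by simp
  have nz: "2 - N \<noteq> 0" "2 - N' \<noteq> 0" using ge[OF N(1)] ge[OF N(2)] by auto
  have "norm u * 1 \<le> norm u * norm (2 - N)" using ge[OF N(1)] by (intro mult_left_mono) auto
  also have "\<dots> = norm r" using u unfolding N_def norm_mult[symmetric] by simp
  finally show "norm u \<le> norm r" by simp
  have ueq: "u = r / (2 - N)" "u' = r / (2 - N')"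
    using u u' nz by (auto simp: N_def N'_def field_simps)
  define E where "E = cnj (2 - N) * (2 - N') - of_real ((norm r)\<^sup>2)"
  have d: "norm (u - u') = norm r * norm (N - N') / (norm (2 - N) * norm (2 - N'))"
  proof -
    have "u - u' = r * (N - N') / ((2 - N) * (2 - N'))"
      unfolding ueq using nz by (simp add: divide_simps) (simp add: algebra_simps)
    then show ?thesis by (simp add: norm_mult norm_divide)
  qed
  have e: "norm (1 - cnj u * u') = norm E / (norm (2 - N) * norm (2 - N'))"
  proof -
    have c: "cnj (2 - N) \<noteq> 0" using nz by (metis complex_cnj_zero_iff)
    have "1 - cnj u * u' = E / (cnj (2 - N) * (2 - N'))"
      unfolding ueq E_def complex_norm_square using nz c
      by (simp add: divide_simps del: complex_cnj_diff)
    then show ?thesis by (simp only: norm_mult norm_divide complex_mod_cnj)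
  qed
  have Eeq: "(norm E)\<^sup>2 = (norm r)\<^sup>2 * (norm (N - N'))\<^sup>2
      + ((norm (2 - N))\<^sup>2 - (norm r)\<^sup>2) * ((norm (2 - N'))\<^sup>2 - (norm r)\<^sup>2)"
  proof -
    \<comment> \<open>A scaled form of \<open>norm_one_minus_cnj_mult\<close>, which is its case
      \<open>s = 1\<close>.\<close>
    have *: "(norm (cnj a * b - of_real s))\<^sup>2 = s * (norm (a - b))\<^sup>2 + ((norm a)\<^sup>2 - s) * ((norm b)\<^sup>2 - s)"
      for a b :: complex and s :: real
      unfolding cmod_power2 by (simp add: power2_eq_square algebra_simps)
    show ?thesis unfolding E_def * by (simp add: norm_minus_commute)
  qed
  have "(norm (N - N'))\<^sup>2 \<le> (norm r * norm E)\<^sup>2"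
  proof -
    have "(norm r)^4 = (norm r)\<^sup>2 * (norm r)\<^sup>2" by simp
    then show ?thesis
      using contraction_aux2[of "norm r" N N'] r N
      unfolding power_mult_distrib Eeq by (simp only: left_diff_distrib distrib_left mult_1_left) simp
  qed
  then have le: "norm (N - N') \<le> norm r * norm E" by (rule power2_le_imp_le) simp
  show "pseudo_hdist u u' \<le> (norm r)\<^sup>2"
  proof (cases "E = 0")
    case False
    have p: "norm (2 - N) > 0" "norm (2 - N') > 0" using nz by auto
    have "pseudo_hdist u u' = norm r * norm (N - N') / norm E"
      unfolding pseudo_hdist_def d e using p by simp
    also have "\<dots> \<le> norm r * (norm r * norm E) / norm E"
      using le by (intro divide_right_mono mult_left_mono) auto
    finally show ?thesis using False by (simp add: power2_eq_square)
  \<comment> \<open>For \<open>E = 0\<close> the denominator of \<open>pseudo_hdist\<close> is 0,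
    and the quotient is 0 by convention.\<close>
  qed (simp add: pseudo_hdist_def e)
qed

lemma pseudo_hdist_harm:
  assumes z: "norm z < 1" and w: "norm w < 1" and \<nu>: "norm \<nu> \<le> 1" "norm \<nu>' \<le> 1"
    and h: "harm z w \<nu> u" and h': "harm z w \<nu>' u'"
  shows "pseudo_hdist z u \<le> pseudo_hdist z w" "pseudo_hdist u u' \<le> (pseudo_hdist z w)\<^sup>2"
proof -
  text \<open>\<open>T\<close> moves \<open>z\<close> to the origin, and \<open>S\<close> is the same map in the coordinate \<open>1/x\<close>.\<close>
  define T where "T x = (x - z) / (1 - cnj z * x)" for x
  define S where "S x = (x - cnj z) / (1 - z * x)" for x
  have r: "max (norm z) (norm w) < 1" using z w by simp
  have u: "norm u < 1" "norm u' < 1"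
    using harm_norm_le[OF h \<nu>(1) _ _ r] harm_norm_le[OF h' \<nu>(2) _ _ r] r by auto
  have Tz: "T z = 0" by (simp add: T_def)
  have T: "norm (T x) = pseudo_hdist z x" if "norm x < 1" for x
    using pseudo_hdist_moebius[OF z z that] by (simp add: T_def[symmetric] Tz) (simp add: pseudo_hdist_def)
  have S: "norm (S x) \<le> 1" if "norm x \<le> 1" for x
  proof -
    have "0 \<le> (1 - (norm (cnj z))\<^sup>2) * (1 - (norm x)\<^sup>2)"
      using z that by (intro mult_nonneg_nonneg) (auto simp: power_le_one)
    then have "(norm (x - cnj z))\<^sup>2 \<le> (norm (1 - z * x))\<^sup>2"
      using norm_one_minus_cnj_mult[of "cnj z" x] by (simp add: norm_minus_commute)
    then have "norm (x - cnj z) \<le> norm (1 - z * x)" by (rule power2_le_imp_le) simp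
    then show ?thesis unfolding S_def norm_divide by (metis divide_le_eq_1 norm_ge_zero order_le_less)
  qed
  have eq: "T x * (2 - S \<mu> * T w) = T w" if "norm \<mu> \<le> 1" "norm x < 1" "harm z w \<mu> x" for \<mu> x
  proof -
    have nz: "1 - cnj z * x \<noteq> 0" "1 - cnj z * w \<noteq> 0" "1 - z * \<mu> \<noteq> 0" "1 - cnj z * z \<noteq> 0"
      using z w that one_minus_mult_nonzero[of \<mu> z] one_minus_mult_nonzero[of "cnj z"]
      by (simp_all add: mult.commute[of z \<mu>])
    \<comment> \<open>With denominators cleared, the two sides of the claimed equation differ by the
      expression in \<open>harm\<close> times \<open>1 - |z|^2\<close>.\<close>
    have "(x - z) * (2 * ((1 - z * \<mu>) * (1 - cnj z * w)) - (\<mu> - cnj z) * (w - z))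
       - (w - z) * (1 - z * \<mu>) * (1 - cnj z * x) =
       (1 - cnj z * z) * ((x - z) * (1 - \<mu> * w) + (x - w) * (1 - \<mu> * z))"
      by (simp add: algebra_simps)
    then have e: "(x - z) * (2 * ((1 - z * \<mu>) * (1 - cnj z * w)) - (\<mu> - cnj z) * (w - z))
       = (w - z) * (1 - z * \<mu>) * (1 - cnj z * x)"
      using that(3) unfolding harm_def by simp
    have "T x * (2 - S \<mu> * T w) =
      ((x - z) * (2 * ((1 - z * \<mu>) * (1 - cnj z * w)) - (\<mu> - cnj z) * (w - z))) /
      ((1 - cnj z * x) * ((1 - z * \<mu>) * (1 - cnj z * w)))"
    proof -
      have "a / b * (2 - c / d * (e / f)) = a * (2 * (d * f) - c * e) / (b * (d * f))"
        if "b \<noteq> 0" "d \<noteq> 0" "f \<noteq> 0" for a b c d e f :: complex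
        using that by (simp add: field_simps)
      from this[OF nz(1) nz(3) nz(2)] show ?thesis unfolding T_def S_def .
    qed
    also have "\<dots> = T w" unfolding e T_def using nz by simp
    finally show ?thesis .
  qed
  have Tw: "norm (T w) < 1" unfolding T[OF w] by (rule pseudo_hdist_less_1[OF z w])
  note * = pseudo_hdist_harm_origin[OF Tw S[OF \<nu>(1)] S[OF \<nu>(2)] eq[OF \<nu>(1) u(1) h] eq[OF \<nu>(2) u(2) h']]
  show "pseudo_hdist z u \<le> pseudo_hdist z w" using *(1) unfolding T[OF w] T[OF u(1)] .
  show "pseudo_hdist u u' \<le> (pseudo_hdist z w)\<^sup>2"
    using *(2) pseudo_hdist_moebius[OF z u] unfolding T[OF w] by (simp add: T_def)
qed

section \<open>Quadratically convergent sequences\<close>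

text \<open>The exponent is \<open>2 ^ n\<close>, and \<open>q = exp (- D)\<close> turns the bound
  into \<open>C * exp (- D * 2 ^ n)\<close>. Fixing one base \<open>q\<close> for all sequences lets
  sums, products and quotients keep the same rate, with only \<open>C\<close> changing.\<close>

definition qconv :: "real \<Rightarrow> (nat \<Rightarrow> complex) \<Rightarrow> complex \<Rightarrow> bool" where
  "qconv q x l \<longleftrightarrow> (\<exists>C. \<forall>n. norm (x n - l) \<le> C * q ^ 2 ^ n)"

lemma qconv_const [simp]: "qconv q (\<lambda>_. c) c"
  unfolding qconv_def by (intro exI[of _ 0]) simp

text \<open>Follows from \<open>2 ^ n + j \<le> 2 ^ (n + j)\<close>. A tail of the doubly
  exponential series is thus dominated by its first bound times a geometric series, so that summing
  steps does not worsen the rate.\<close>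

lemma rate_add_le:
  assumes "0 < (q::real)" "q < 1"
  shows "q ^ 2 ^ (n + j) \<le> q ^ 2 ^ n * q ^ j"
proof -
  have "j < 2 ^ j" by simp
  then have "j + 1 \<le> 2 ^ j" by linarith
  then have "2 ^ n * (j + 1) \<le> 2 ^ n * (2::nat) ^ j" by (rule mult_le_mono2)
  moreover have "j \<le> j * 2 ^ n" by simp
  moreover have "2 ^ n * (j + 1) = j * 2 ^ n + 2 ^ n" by simp
  ultimately have "2 ^ n + j \<le> 2 ^ n * (2::nat) ^ j" by linarith
  then have "2 ^ n + j \<le> (2::nat) ^ (n + j)" by (simp only: power_add)
  then have "q ^ 2 ^ (n + j) \<le> q ^ (2 ^ n + j)"
    by (rule power_decreasing) (use assms in auto)
  then show ?thesis by (simp add: power_add)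
qed

lemma summable_rate:
  assumes "0 < (q::real)" "q < 1"
  shows "summable (\<lambda>n. q ^ 2 ^ n)"
proof (rule summable_comparison_test')
  show "summable (\<lambda>n. q ^ n)" using assms by simp
  show "norm (q ^ 2 ^ n) \<le> q ^ n" for n
    using assms by (simp add: power_decreasing less_imp_le)
qed

text \<open>Finitely many initial terms are absorbed into the constant. This serves sequences whose
  terms are non-zero only from some index on.\<close>

lemma qconv_eventuallyI:
  assumes q: "0 < q" and ev: "\<forall>\<^sub>F n in sequentially. norm (x n - l) \<le> C * q ^ 2 ^ n"
  shows "qconv q x l"
proof -
  obtain N where N: "\<And>n. n \<ge> N \<Longrightarrow> norm (x n - l) \<le> C * q ^ 2 ^ n"
    using ev unfolding eventually_sequentially by auto
  define B where "B = \<bar>C\<bar> + (\<Sum>i<N. norm (x i - l) / q ^ 2 ^ i)"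
  have "norm (x n - l) \<le> B * q ^ 2 ^ n" for n
  proof (cases "n < N")
    case True
    have "norm (x n - l) / q ^ 2 ^ n \<le> (\<Sum>i<N. norm (x i - l) / q ^ 2 ^ i)"
      using True q by (intro member_le_sum) auto
    then have "norm (x n - l) / q ^ 2 ^ n \<le> B" unfolding B_def by linarith
    then show ?thesis using q by (simp add: pos_divide_le_eq)
  next
    case False
    have "0 \<le> (\<Sum>i<N. norm (x i - l) / q ^ 2 ^ i)" using q by (intro sum_nonneg) auto
    then have "C \<le> B" unfolding B_def by linarith
    then have "C * q ^ 2 ^ n \<le> B * q ^ 2 ^ n" using q by (intro mult_right_mono) auto
    then show ?thesis using N[of n] False by simp
  qed
  then show ?thesis unfolding qconv_def by blast
qed

lemma qconv_tendsto:
  assumes "0 < q" "q < 1" "qconv q x l"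
  shows "x \<longlonglongrightarrow> l"
proof -
  obtain C where C: "\<And>n. norm (x n - l) \<le> C * q ^ 2 ^ n"
    using assms(3) unfolding qconv_def by auto
  have "(\<lambda>n. q ^ 2 ^ n) \<longlonglongrightarrow> 0"
    using summable_rate[OF assms(1,2)] by (rule summable_LIMSEQ_zero)
  then have "(\<lambda>n. C * q ^ 2 ^ n) \<longlonglongrightarrow> 0"
    using tendsto_mult_left[of "\<lambda>n. q ^ 2 ^ n" 0 sequentially C] by simp
  then have "(\<lambda>n. x n - l) \<longlonglongrightarrow> 0"
    by (rule Lim_null_comparison[rotated]) (rule always_eventually, use C in blast)
  then show ?thesis by (simp add: LIM_zero_iff)
qed

lemma qconv_add:
  assumes "qconv q x l" "qconv q y m"
  shows "qconv q (\<lambda>n. x n + y n) (l + m)"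
proof -
  obtain C where C: "\<And>n. norm (x n - l) \<le> C * q ^ 2 ^ n"
    using assms(1) unfolding qconv_def by auto
  obtain C' where C': "\<And>n. norm (y n - m) \<le> C' * q ^ 2 ^ n"
    using assms(2) unfolding qconv_def by auto
  have "norm (x n + y n - (l + m)) \<le> (C + C') * q ^ 2 ^ n" for n
    using norm_diff_triangle_ineq[of "x n" "y n" l m] C[of n] C'[of n] by (simp add: algebra_simps)
  then show ?thesis unfolding qconv_def by blast
qed

lemma LIMSEQ_bounded:
  fixes x :: "nat \<Rightarrow> 'a::real_normed_vector"
  assumes "x \<longlonglongrightarrow> l"
  obtains B where "0 < B" "\<And>n. norm (x n) \<le> B"
  using convergent_imp_Bseq[OF convergentI[OF assms]] unfolding Bseq_def by auto

lemma qconv_bounded: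
  assumes "0 < q" "q < 1" "qconv q x l"
  obtains B where "0 < B" "\<And>n. norm (x n) \<le> B"
  using LIMSEQ_bounded[OF qconv_tendsto[OF assms]] by blast

lemma qconv_mult:
  assumes q: "0 < q" "q < 1" and x: "qconv q x l" and y: "qconv q y m"
  shows "qconv q (\<lambda>n. x n * y n) (l * m)"
proof -
  obtain C where C: "\<And>n. norm (x n - l) \<le> C * q ^ 2 ^ n"
    using x unfolding qconv_def by auto
  obtain C' where C': "\<And>n. norm (y n - m) \<le> C' * q ^ 2 ^ n"
    using y unfolding qconv_def by auto
  obtain B where B: "0 < B" "\<And>n. norm (y n) \<le> B" using qconv_bounded[OF q y] by blast
  have "norm (x n * y n - l * m) \<le> (C * B + norm l * C') * q ^ 2 ^ n" for n
  proof -
    have "x n * y n - l * m = (x n - l) * y n + l * (y n - m)" by (simp add: algebra_simps)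
    then have "norm (x n * y n - l * m) \<le> norm (x n - l) * norm (y n) + norm l * norm (y n - m)"
      by (metis norm_mult norm_triangle_ineq)
    also have "\<dots> \<le> (C * q ^ 2 ^ n) * B + norm l * (C' * q ^ 2 ^ n)"
    proof (intro add_mono mult_mono mult_left_mono C C' B(2))
      show "0 \<le> C * q ^ 2 ^ n" using order_trans[OF norm_ge_zero C] .
    qed auto
    finally show ?thesis by (simp add: algebra_simps)
  qed
  then show ?thesis unfolding qconv_def by blast
qed

lemma qconv_diff:
  assumes "0 < q" "q < 1" "qconv q x l" "qconv q y m"
  shows "qconv q (\<lambda>n. x n - y n) (l - m)"
  using qconv_add[OF assms(3) qconv_mult[OF assms(1,2) qconv_const[of q "- 1"] assms(4)]] by simp

lemma qconv_cong:
  assumes "0 < q" "qconv q x l" "\<forall>\<^sub>F n in sequentially. x n = y n"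
  shows "qconv q y l"
proof -
  obtain C where C: "\<And>n. norm (x n - l) \<le> C * q ^ 2 ^ n"
    using assms(2) unfolding qconv_def by auto
  have "\<forall>\<^sub>F n in sequentially. norm (y n - l) \<le> C * q ^ 2 ^ n"
    using assms(3)
  proof eventually_elim
    case (elim n)
    show ?case using C[of n] unfolding elim .
  qed
  then show ?thesis by (rule qconv_eventuallyI[OF assms(1)])
qed

lemma qconv_inverse:
  assumes q: "0 < q" "q < 1" and x: "qconv q x l" and l: "l \<noteq> 0"
  shows "qconv q (\<lambda>n. inverse (x n)) (inverse l)"
proof -
  obtain C where C: "\<And>n. norm (x n - l) \<le> C * q ^ 2 ^ n"
    using x unfolding qconv_def by auto
  have "(\<lambda>n. inverse (x n)) \<longlonglongrightarrow> inverse l"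
    using qconv_tendsto[OF q x] l by (rule tendsto_inverse)
  then obtain B where B: "0 < B" "\<And>n. norm (inverse (x n)) \<le> B"
    by (rule LIMSEQ_bounded) (rule that)
  have "\<forall>\<^sub>F n in sequentially. x n \<noteq> 0"
    using qconv_tendsto[OF q x] l by (rule tendsto_imp_eventually_ne)
  then have "\<forall>\<^sub>F n in sequentially.
      norm (inverse (x n) - inverse l) \<le> (B * C * norm (inverse l)) * q ^ 2 ^ n"
  proof eventually_elim
    case (elim n)
    have "norm (inverse (x n) - inverse l)
        = norm (inverse (x n)) * norm (x n - l) * norm (inverse l)"
      unfolding inverse_diff_inverse[OF elim l] by (simp only: norm_mult norm_minus_cancel)
    also have "\<dots> \<le> B * (C * q ^ 2 ^ n) * norm (inverse l)"
      by (intro mult_right_mono mult_mono B(2) C) (use B(1) in auto)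
    finally show ?case by (simp add: algebra_simps)
  qed
  then show ?thesis by (rule qconv_eventuallyI[OF q(1)])
qed

lemma qconv_divide:
  assumes "0 < q" "q < 1" "qconv q x l" "qconv q y m" "m \<noteq> 0"
  shows "qconv q (\<lambda>n. x n / y n) (l / m)"
  unfolding divide_inverse by (rule qconv_mult[OF assms(1-3) qconv_inverse[OF assms(1,2,4,5)]])

lemma qconv_Suc:
  assumes "0 < q" "q < 1" "qconv q x l"
  shows "qconv q (\<lambda>n. x (Suc n)) l"
proof -
  obtain C where C: "\<And>n. norm (x n - l) \<le> C * q ^ 2 ^ n"
    using assms(3) unfolding qconv_def by auto
  have "0 \<le> C * q ^ 2 ^ 0" using order_trans[OF norm_ge_zero C] .
  then have C0: "0 \<le> C" using assms(1) by (simp add: zero_le_mult_iff)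
  have "norm (x (Suc n) - l) \<le> C * q ^ 2 ^ n" for n
  proof -
    have "q ^ 2 ^ Suc n \<le> q ^ 2 ^ n"
      by (rule power_decreasing) (use assms(1,2) in auto)
    from mult_left_mono[OF this C0] C[of "Suc n"] show ?thesis by linarith
  qed
  then show ?thesis unfolding qconv_def by blast
qed

text \<open>The distance from the \<open>n\<close>-th term to any later one is at most
  \<open>C / (1 - q) * q ^ 2 ^ n\<close>, uniformly in the later index, and this bound passes to the
  limit.\<close>

lemma qconv_of_steps:
  assumes q: "0 < q" "q < 1" and step: "\<And>n. norm (x (Suc n) - x n) \<le> C * q ^ 2 ^ n"
  obtains l where "qconv q x l"
proof -
  have "0 \<le> C * q ^ 2 ^ 0" using order_trans[OF norm_ge_zero step] .
  then have C0: "0 \<le> C" using q by (simp add: zero_le_mult_iff)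
  have 1: "norm (x (n + j) - x n) \<le> C * q ^ 2 ^ n * (\<Sum>i<j. q ^ i)" for n j
  proof (induction j)
    case (Suc j)
    have "norm (x (n + Suc j) - x n) \<le> norm (x (Suc (n + j)) - x (n + j)) + norm (x (n + j) - x n)"
      using norm_triangle_ineq[of "x (Suc (n + j)) - x (n + j)" "x (n + j) - x n"] by simp
    also have "norm (x (Suc (n + j)) - x (n + j)) \<le> C * (q ^ 2 ^ n * q ^ j)"
      using step[of "n + j"] mult_left_mono[OF rate_add_le[OF q] C0] by (rule order_trans)
    finally show ?case using Suc by (simp add: algebra_simps)
  qed simp
  have geo: "(\<Sum>i<j. q ^ i) \<le> 1 / (1 - q)" for j
    using sum_le_suminf[of "\<lambda>i. q ^ i" "{..<j}"] q suminf_geometric[of q] by simp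
  have 2: "norm (x (n + j) - x n) \<le> C / (1 - q) * q ^ 2 ^ n" for n j
  proof -
    have "C * q ^ 2 ^ n * (\<Sum>i<j. q ^ i) \<le> C * q ^ 2 ^ n * (1 / (1 - q))"
      using geo C0 q by (intro mult_left_mono) auto
    then show ?thesis using 1[of n j] by simp
  qed
  have "summable (\<lambda>n. x (Suc n) - x n)"
    by (rule summable_comparison_test'[OF summable_mult[OF summable_rate[OF q]]]) (rule step)
  then have "convergent (\<lambda>n. \<Sum>i<n. x (Suc i) - x i)" by (simp add: summable_iff_convergent)
  then have "convergent (\<lambda>n. x n - x 0)" by (simp add: sum_lessThan_telescope)
  then obtain m where m: "(\<lambda>n. x n - x 0) \<longlonglongrightarrow> m" unfolding convergent_def by blast
  have lim: "x \<longlonglongrightarrow> m + x 0" using tendsto_add[OF m tendsto_const[of "x 0"]] by simp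
  have "norm (x n - (m + x 0)) \<le> C / (1 - q) * q ^ 2 ^ n" for n
  proof -
    have "(\<lambda>j. norm (x (j + n) - x n)) \<longlonglongrightarrow> norm (m + x 0 - x n)"
      by (rule tendsto_norm[OF tendsto_diff[OF LIMSEQ_ignore_initial_segment[OF lim] tendsto_const]])
    then have "norm (m + x 0 - x n) \<le> C / (1 - q) * q ^ 2 ^ n"
      by (rule LIMSEQ_le_const2) (use 2[of n] in \<open>auto simp: add.commute\<close>)
    then show ?thesis by (simp add: norm_minus_commute)
  qed
  then have "qconv q x (m + x 0)" unfolding qconv_def by blast
  then show thesis by (rule that)
qed

text \<open>Summability of \<open>|R n - 1|\<close> makes the infinite product of the quotients
  converge to a non-zero value, which keeps the scalar factors from tending to 0. Since
  \<open>x\<close> is then bounded, the estimate for quotients becomes one for differences.\<close>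

lemma qconv_of_quotients:
  assumes q: "0 < q" "q < 1" and nz: "\<And>n. x n \<noteq> 0"
    and R: "qconv q (\<lambda>n. x (Suc n) / x n) 1"
  obtains l where "l \<noteq> 0" "qconv q x l"
proof -
  define R where "R n = x (Suc n) / x n" for n
  obtain C where C: "\<And>n. norm (R n - 1) \<le> C * q ^ 2 ^ n"
    using R unfolding qconv_def R_def by auto
  have "summable (\<lambda>n. norm (R n - 1))"
    by (rule summable_comparison_test'[OF summable_mult[OF summable_rate[OF q]]]) (use C in simp)
  then have "convergent_prod R"
    by (intro abs_convergent_prod_imp_convergent_prod) (simp add: abs_convergent_prod_conv_summable)
  then have pr: "(\<lambda>n. \<Prod>i\<le>n. R i) \<longlonglongrightarrow> prodinf R" "prodinf R \<noteq> 0"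
  proof -
    have "R i \<noteq> 0" for i using nz by (simp add: R_def)
    then show "prodinf R \<noteq> 0" using \<open>convergent_prod R\<close> by (rule prodinf_nonzero[rotated])
  qed (rule convergent_prod_LIMSEQ)
  have xR: "x (Suc n) = x 0 * (\<Prod>i\<le>n. R i)" for n
  proof (induction n)
    case (Suc n)
    then show ?case using nz[of "Suc n"] by (simp add: R_def)
  qed (use nz in \<open>simp add: R_def\<close>)
  have "(\<lambda>n. x (Suc n)) \<longlonglongrightarrow> x 0 * prodinf R"
    unfolding xR by (rule tendsto_mult_left[OF pr(1)])
  then have lim: "x \<longlonglongrightarrow> x 0 * prodinf R" by (simp add: filterlim_sequentially_Suc)
  then obtain B where B: "0 < B" "\<And>n. norm (x n) \<le> B"
    by (rule LIMSEQ_bounded) (rule that)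
  have "norm (x (Suc n) - x n) \<le> (B * C) * q ^ 2 ^ n" for n
  proof -
    have "x (Suc n) - x n = x n * (R n - 1)" using nz[of n] by (simp add: R_def right_diff_distrib)
    then have "norm (x (Suc n) - x n) = norm (x n) * norm (R n - 1)" by (simp add: norm_mult)
    also have "\<dots> \<le> B * (C * q ^ 2 ^ n)" using B C by (intro mult_mono) auto
    finally show ?thesis by simp
  qed
  then obtain l where l: "qconv q x l" using qconv_of_steps[OF q] by blast
  then have "l = x 0 * prodinf R" using qconv_tendsto[OF q] lim LIMSEQ_unique by blast
  then have "l \<noteq> 0" using pr nz by simp
  then show thesis using l by (rule that)
qed

lemma harm_sequence_qconv:
  fixes z w \<nu> \<nu>' :: "nat \<Rightarrow> complex"
  assumes init: "norm (z 0) < 1" "norm (w 0) < 1"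
    and step: "\<And>n. \<exists>\<nu>. norm \<nu> \<le> 1 \<and> harm (z n) (w n) \<nu> (z (Suc n))"
    and step': "\<And>n. \<exists>\<nu>. norm \<nu> \<le> 1 \<and> harm (z n) (w n) \<nu> (w (Suc n))"
    and q: "0 < q" "q < 1" "pseudo_hdist (z 0) (w 0) \<le> q"
  obtains l where "norm l < 1" "qconv q z l" "qconv q w l"
proof -
  define r where "r = max (norm (z 0)) (norm (w 0))"
  have r: "r < 1" using init by (simp add: r_def)
  have zw: "norm (z n) \<le> r \<and> norm (w n) \<le> r" for n
  proof (induction n)
    case (Suc n)
    then show ?case using step[of n] step'[of n] harm_norm_le r by blast
  qed (simp add: r_def)
  have zw1: "norm (z n) < 1" "norm (w n) < 1" for n using zw[of n] r by auto
  have \<rho>: "pseudo_hdist (z n) (w n) \<le> q ^ 2 ^ n" for n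
  proof (induction n)
    case (Suc n)
    have "pseudo_hdist (z (Suc n)) (w (Suc n)) \<le> (pseudo_hdist (z n) (w n))\<^sup>2"
      using step[of n] step'[of n] pseudo_hdist_harm(2)[OF zw1] by blast
    also have "\<dots> \<le> (q ^ 2 ^ n)\<^sup>2" using Suc pseudo_hdist_nonneg by (intro power_mono) auto
    also have "\<dots> = q ^ 2 ^ Suc n" by (simp add: power_mult[symmetric] mult.commute)
    finally show ?case .
  qed (use q in simp)
  have "norm (z (Suc n) - z n) \<le> 2 * q ^ 2 ^ n" for n
  proof -
    have "norm (z n - z (Suc n)) \<le> 2 * pseudo_hdist (z n) (z (Suc n))"
      by (intro norm_diff_le_pseudo_hdist zw1)
    also have "pseudo_hdist (z n) (z (Suc n)) \<le> pseudo_hdist (z n) (w n)"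
      using step[of n] pseudo_hdist_harm(1)[OF zw1] by blast
    finally show ?thesis using \<rho>[of n] by (simp add: norm_minus_commute)
  qed
  then obtain l where l: "qconv q z l" using qconv_of_steps[OF q(1,2)] by blast
  have "norm (w n - z n - 0) \<le> 2 * q ^ 2 ^ n" for n
    using norm_diff_le_pseudo_hdist[OF zw1, of n n] \<rho>[of n] by (simp add: norm_minus_commute)
  then have "qconv q (\<lambda>n. w n - z n) 0" unfolding qconv_def by blast
  then have w: "qconv q w l" using qconv_add[OF l] by fastforce
  have "(\<lambda>n. norm (z n)) \<longlonglongrightarrow> norm l" by (rule tendsto_norm[OF qconv_tendsto[OF q(1,2) l]])
  \<comment> \<open>The strict bounds alone would allow a limit on the unit circle; the closed disc
    of radius \<open>r < 1\<close> excludes it.\<close>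
  then have "norm l \<le> r" by (rule LIMSEQ_le_const2) (use zw in auto)
  then have "norm l < 1" using r by simp
  then show thesis using l w by (rule that)
qed

section \<open>Quadratic forms with roots in discs\<close>

type_synonym hvec = "complex \<times> complex"

text \<open>Points of the projective line in homogeneous coordinates: \<open>(X, Y)\<close> stands for \<open>X / Y\<close>,
  and \<open>lform\<close> is the linear form with this root. A Moebius matrix is given by its two columns, so
  that the image of \<open>z\<close> and its linear form depend affinely on \<open>z\<close>, infinity included.\<close>

definition cross :: "hvec \<Rightarrow> hvec \<Rightarrow> complex" where
  "cross u v = fst u * snd v - snd u * fst v"

definition lform :: "hvec \<Rightarrow> complex poly" where
  "lform v = [:- fst v, snd v:]"

definition point :: "hvec \<Rightarrow> cp1" where
  "point v = (if snd v = 0 then None else Some (fst v / snd v))"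

definition mvec :: "hvec \<times> hvec \<Rightarrow> complex \<Rightarrow> hvec" where
  "mvec M z = (z * fst (fst M) + fst (snd M), z * snd (fst M) + snd (snd M))"

definition mdet :: "hvec \<times> hvec \<Rightarrow> complex" where
  "mdet M = cross (fst M) (snd M)"

definition mdisc :: "hvec \<times> hvec \<Rightarrow> cp1 set" where
  "mdisc M = (\<lambda>z. point (mvec M z)) ` ball 0 1"

definition mdisjoint :: "hvec \<times> hvec \<Rightarrow> hvec \<times> hvec \<Rightarrow> bool" where
  "mdisjoint M N \<longleftrightarrow> (\<forall>y\<in>ball 0 1. \<forall>y'\<in>ball 0 1. cross (mvec M y) (mvec N y') \<noteq> 0)"

definition qform :: "hvec \<times> hvec \<Rightarrow> complex \<Rightarrow> complex \<Rightarrow> complex poly" where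
  "qform M z w = lform (mvec M z) * lform (mvec M w)"

lemma cross_self [simp]: "cross v v = 0"
  by (simp add: cross_def)

lemma cross_swap: "cross v u = - cross u v"
  by (simp add: cross_def)

lemma mdisjoint_sym: "mdisjoint M N \<Longrightarrow> mdisjoint N M"
  unfolding mdisjoint_def by (metis cross_swap neg_equal_0_iff_equal)

lemma mdisjointD: "mdisjoint M N \<Longrightarrow> norm y < 1 \<Longrightarrow> norm y' < 1 \<Longrightarrow> cross (mvec M y) (mvec N y') \<noteq> 0"
  by (simp add: mdisjoint_def)

lemma cross_mvec: "cross (mvec M z) (mvec M w) = mdet M * (z - w)"
  by (simp add: cross_def mvec_def mdet_def algebra_simps)

lemma lform_eq_0_iff: "lform v = 0 \<longleftrightarrow> v = (0, 0)"
  by (cases v) (simp add: lform_def)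

lemma mvec_nonzero: "mdet M \<noteq> 0 \<Longrightarrow> mvec M z \<noteq> (0, 0)"
proof
  assume "mdet M \<noteq> 0" "mvec M z = (0, 0)"
  moreover have "cross (mvec M (z + 1)) (mvec M z) = mdet M" by (simp add: cross_mvec)
  ultimately show False by (simp add: cross_def)
qed

lemma lform_mvec_nonzero: "mdet M \<noteq> 0 \<Longrightarrow> lform (mvec M z) \<noteq> 0"
  by (simp add: lform_eq_0_iff mvec_nonzero)

lemma poly_lform: "poly (lform v) t = snd v * t - fst v"
  by (simp add: lform_def)

lemma poly_lform_mvec: "poly (lform (mvec M z)) t = z * poly (lform (fst M)) t + poly (lform (snd M)) t"
  by (simp add: poly_lform mvec_def algebra_simps)

lemma poly_eqI_eval: "(\<And>t. poly p t = poly q t) \<Longrightarrow> p = (q :: complex poly)"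
  by (simp add: poly_eq_poly_eq_iff[symmetric] ext)

lemma pderiv_lform: "pderiv (lform v) = [:snd v:]"
  by (simp add: lform_def pderiv_pCons)

text \<open>The Leibniz rule, pairing \<open>a\<close> with \<open>c\<close> and \<open>b\<close>
  with \<open>d\<close>: for linear forms, \<open>a' c - a c'\<close> is the constant
  \<open>cross a c\<close>.\<close>

lemma bracket_lform:
  "bracket (lform a * lform b) (lform c * lform d) =
     smult (cross a c) (lform b * lform d) + smult (cross b d) (lform a * lform c)"
  by (rule poly_eqI_eval)
    (simp add: bracket_def pderiv_mult pderiv_lform poly_lform cross_def algebra_simps)

lemma bracket_smult: "bracket (smult a p) (smult b q) = smult (a * b) (bracket p q)"
  by (simp add: bracket_def pderiv_smult smult_diff_right mult.commute)

lemma bracket_swap: "bracket q p = - bracket p q"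
  by (simp add: bracket_def mult.commute)

text \<open>Evaluation of an element of \<open>polys_upto 2\<close> as a binary quadratic form.\<close>

definition hev :: "complex poly \<Rightarrow> hvec \<Rightarrow> complex" where
  "hev p v = coeff p 2 * (fst v)\<^sup>2 + coeff p 1 * fst v * snd v + coeff p 0 * (snd v)\<^sup>2"

lemma hev_add: "hev (p + q) v = hev p v + hev q v"
  by (simp add: hev_def algebra_simps)

lemma hev_smult: "hev (smult c p) v = c * hev p v"
  by (simp add: hev_def algebra_simps)

lemma hev_0 [simp]: "hev 0 v = 0"
  by (simp add: hev_def)

lemma hev_lform: "hev (lform a * lform b) v = cross v a * cross v b"
  by (simp add: hev_def lform_def cross_def algebra_simps numeral_2_eq_2)

text \<open>Cramer's rule writes \<open>c\<close> as \<open>x\<close> times the first column plus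
  \<open>y\<close> times the second. It meets the disc at the parameter \<open>x / y\<close>, so
  avoiding the disc forces \<open>|y| \<le> |x|\<close>. In the disc coordinate, \<open>c\<close> is
  the point \<open>1/\<alpha>\<close> with \<open>\<alpha> = y / x\<close>.\<close>

lemma exterior_rep:
  assumes M: "mdet M \<noteq> 0" and c: "\<And>y. norm y < 1 \<Longrightarrow> cross (mvec M y) c \<noteq> 0"
  obtains x \<alpha> where "x \<noteq> 0" "norm \<alpha> \<le> 1"
    "c = (x * (fst (fst M) + \<alpha> * fst (snd M)), x * (snd (fst M) + \<alpha> * snd (snd M)))"
proof -
  define x where "x = cross c (snd M) / mdet M"
  define y where "y = cross (fst M) c / mdet M"
  have ceq: "c = (x * fst (fst M) + y * fst (snd M), x * snd (fst M) + y * snd (snd M))"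
  proof (rule prod_eqI)
    have "mdet M * fst c = cross c (snd M) * fst (fst M) + cross (fst M) c * fst (snd M)"
      by (simp add: cross_def mdet_def algebra_simps)
    then show "fst c = fst (x * fst (fst M) + y * fst (snd M), x * snd (fst M) + y * snd (snd M))"
      using M by (simp add: x_def y_def field_simps)
    have "mdet M * snd c = cross c (snd M) * snd (fst M) + cross (fst M) c * snd (snd M)"
      by (simp add: cross_def mdet_def algebra_simps)
    then show "snd c = snd (x * fst (fst M) + y * fst (snd M), x * snd (fst M) + y * snd (snd M))"
      using M by (simp add: x_def y_def field_simps)
  qed
  have ev: "cross (mvec M t) c = (t * y - x) * mdet M" for t
    unfolding ceq by (simp add: cross_def mvec_def mdet_def algebra_simps)
  have le: "norm y \<le> norm x"
  proof (rule ccontr)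
    assume "\<not> norm y \<le> norm x"
    then have "norm x < norm y" "0 < norm y"
      using norm_ge_zero[of x] by linarith+
    then have "norm (x / y) < 1" "y \<noteq> 0" by (auto simp: norm_divide)
    then show False using c[of "x / y"] ev by simp
  qed
  have x0: "x \<noteq> 0" using c[of 0] ev[of 0] by auto
  show thesis
    by (rule that[of x "y / x"]) (use x0 le ceq in \<open>auto simp: norm_divide field_simps\<close>)
qed

text \<open>What can be seen from one disc alone: a root \<open>u\<close> of the bracket in the
  disc, and a second root \<open>1/\<nu>\<close> known only to lie outside. Its linear form
  \<open>n\<close> is identified later, from the side of the other disc.\<close>

lemma bracket_half:
  assumes M: "mdet M \<noteq> 0" and z: "norm z < 1" and w: "norm w < 1"
    and c: "\<And>y. norm y < 1 \<Longrightarrow> cross (mvec M y) c \<noteq> 0"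
    and d: "\<And>y. norm y < 1 \<Longrightarrow> cross (mvec M y) d \<noteq> 0"
  obtains k u \<nu> n where "k \<noteq> 0" "norm \<nu> \<le> 1" "harm z w \<nu> u"
    "bracket (qform M z w) (lform c * lform d) = smult k (lform (mvec M u) * lform n)"
    "lform n \<noteq> 0"
proof -
  obtain x \<alpha> where x: "x \<noteq> 0" and \<alpha>: "norm \<alpha> \<le> 1" and ceq:
    "c = (x * (fst (fst M) + \<alpha> * fst (snd M)), x * (snd (fst M) + \<alpha> * snd (snd M)))"
    using exterior_rep[OF M c] by blast
  obtain x' \<beta> where x': "x' \<noteq> 0" and \<beta>: "norm \<beta> \<le> 1" and deq:
    "d = (x' * (fst (fst M) + \<beta> * fst (snd M)), x' * (snd (fst M) + \<beta> * snd (snd M)))"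
    using exterior_rep[OF M d] by blast
  text \<open>Up to a scalar, the bracket is \<open>A E\<^sup>2 + B E G + C G\<^sup>2\<close> in the linear forms \<open>E\<close>, \<open>G\<close> of the
    columns of \<open>M\<close>.\<close>
  define A where "A = z * w * (\<alpha> + \<beta>) - (z + w)"
  define B where "B = 2 * (\<alpha> * \<beta> * (z * w) - 1)"
  define C where "C = \<alpha> * \<beta> * (z + w) - (\<alpha> + \<beta>)"
  have B0: "B \<noteq> 0"
  proof -
    have "norm (\<alpha> * \<beta>) \<le> 1" using \<alpha> \<beta> by (simp add: norm_mult mult_le_one)
    moreover have "norm (z * w) < 1" using z w mult_strict_mono'[of "norm z" 1 "norm w" 1]
      by (simp add: norm_mult)
    ultimately show ?thesis using one_minus_mult_nonzero by (fastforce simp: B_def)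
  qed
  obtain k u \<nu> where k: "norm \<nu> \<le> 1" "k * u = A" "k * \<nu> = C" "k * (1 + u * \<nu>) = B"
  proof (cases "C = 0")
    \<comment> \<open>One root is at infinity in the disc coordinate, which \<open>\<nu> = 0\<close>
      encodes.\<close>
    case True
    then show ?thesis using that[of 0 B "A / B"] B0 by simp
  next
    case False
    note kI = that
    define s where "s = csqrt (B\<^sup>2 - 4 * A * C)"
    define u where "u = (B + s) / (2 * C)"
    define v where "v = (B - s) / (2 * C)"
    have s: "s\<^sup>2 = B\<^sup>2 - 4 * A * C" by (simp add: s_def)
    have sum: "C * (u + v) = B" using False by (simp add: u_def v_def field_simps)
    have prod: "C * (u * v) = A"
    proof -
      have "4 * C * (C * (u * v)) = (B + s) * (B - s)" using False by (simp add: u_def v_def field_simps)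
      also have "\<dots> = 4 * C * A" using s by (simp add: algebra_simps power2_eq_square)
      finally show ?thesis using False by simp
    qed
    \<comment> \<open>If \<open>a\<close> and \<open>b\<close> are the two roots and
      \<open>b\<close> is the outer one, then \<open>\<nu> = 1/b\<close>, and comparing coefficients
      gives \<open>k = C * b\<close>.\<close>
    have res: ?thesis if "C * (a + b) = B" "C * (a * b) = A" "\<not> norm b < 1" for a b
    proof (rule kI)
      have b: "b \<noteq> 0" using that(3) by auto
      show "norm (1 / b) \<le> 1" using that(3) by (simp add: norm_divide divide_simps)
      show "(C * b) * a = A" using that(2) by (simp add: mult_ac)
      show "(C * b) * (1 / b) = C" using b by simp
      have "(C * b) * (1 + a * (1 / b)) = C * (a + b)" using b by (simp add: field_simps)
      then show "(C * b) * (1 + a * (1 / b)) = B" using that(1) by simp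
    qed
    \<comment> \<open>The bracket roots \<open>u\<close>, \<open>v\<close> are harmonic conjugates
      with respect to \<open>1/\<alpha>\<close>, \<open>1/\<beta>\<close>, hence not both in the
      disc.\<close>
    have "C * ((1 - \<alpha> * u) * (1 - \<beta> * v) + (1 - \<beta> * u) * (1 - \<alpha> * v)) =
        2 * C - (\<alpha> + \<beta>) * (C * (u + v)) + 2 * (\<alpha> * \<beta>) * (C * (u * v))"
      by (simp add: algebra_simps)
    also have "\<dots> = 0" unfolding sum prod by (simp add: A_def B_def C_def algebra_simps)
    finally have "\<not> (norm u < 1 \<and> norm v < 1)"
      using harmonic_pair_not_inside[OF \<alpha> \<beta>] False by auto
    then show ?thesis using res[of u v] res[of v u] sum prod by (auto simp: add.commute mult.commute)
  qed
  have k0: "k \<noteq> 0" using k(4) B0 by auto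
  have harm: "harm z w \<nu> u"
  proof -
    have "k * ((u - z) * (1 - \<nu> * w) + (u - w) * (1 - \<nu> * z)) =
        2 * (k * u) - (k * (1 + u * \<nu>)) * (z + w) + 2 * (z * w) * (k * \<nu>)"
      by (simp add: algebra_simps)
    also have "\<dots> = 0" unfolding k(2-4) by (simp add: A_def B_def C_def algebra_simps)
    finally show ?thesis using k0 by (simp add: harm_def)
  qed
  define n where "n = (fst (fst M) + \<nu> * fst (snd M), snd (fst M) + \<nu> * snd (snd M))"
  have cr: "cross (mvec M z) c = x * mdet M * (\<alpha> * z - 1)"
    "cross (mvec M w) d = x' * mdet M * (\<beta> * w - 1)"
    unfolding ceq deq by (simp_all add: cross_def mvec_def mdet_def algebra_simps)
  have "bracket (qform M z w) (lform c * lform d) = smult (x * x' * mdet M * k) (lform (mvec M u) * lform n)"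
  proof (rule poly_eqI_eval)
    fix t
    define E where "E = poly (lform (fst M)) t"
    define G where "G = poly (lform (snd M)) t"
    have c': "poly (lform c) t = x * (E + \<alpha> * G)" and d': "poly (lform d) t = x' * (E + \<beta> * G)"
      and n': "poly (lform n) t = E + \<nu> * G"
      unfolding ceq deq n_def E_def G_def by (simp_all add: poly_lform algebra_simps)
    have "(\<alpha> * z - 1) * (w * E + G) * (E + \<beta> * G) + (\<beta> * w - 1) * (z * E + G) * (E + \<alpha> * G)
        = A * E * E + B * E * G + C * G * G"
      unfolding A_def B_def C_def by (simp add: algebra_simps)
    also have "\<dots> = k * ((u * E + G) * (E + \<nu> * G))"
      unfolding k(2-4)[symmetric] by (simp add: algebra_simps)
    finally have *: "(\<alpha> * z - 1) * (w * E + G) * (E + \<beta> * G) + (\<beta> * w - 1) * (z * E + G) * (E + \<alpha> * G)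
        = k * ((u * E + G) * (E + \<nu> * G))" .
    have "poly (bracket (qform M z w) (lform c * lform d)) t = x * x' * mdet M *
       ((\<alpha> * z - 1) * (w * E + G) * (E + \<beta> * G) + (\<beta> * w - 1) * (z * E + G) * (E + \<alpha> * G))"
      unfolding qform_def bracket_lform cr
      by (simp add: poly_lform_mvec c' d' E_def[symmetric] G_def[symmetric]) (simp add: algebra_simps)
    then show "poly (bracket (qform M z w) (lform c * lform d)) t =
        poly (smult (x * x' * mdet M * k) (lform (mvec M u) * lform n)) t"
      unfolding * by (simp add: poly_lform_mvec n' E_def[symmetric] G_def[symmetric])
  qed
  moreover have "cross n (snd M) = mdet M"
    by (simp add: n_def cross_def mdet_def algebra_simps)
  then have "lform n \<noteq> 0" using M by (auto simp: lform_eq_0_iff cross_def)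
  ultimately show thesis
    using k0 x x' M k(1) harm by (intro that[of "x * x' * mdet M * k" \<nu> u n]) auto
qed

lemma cross_eq_0D:
  assumes "cross u v = 0" "v \<noteq> (0, 0)"
  obtains t where "lform u = smult t (lform v)"
proof (cases "snd v = 0")
  case True
  then have "fst v \<noteq> 0" using assms(2) by (metis prod.collapse)
  moreover have "snd u = 0" using assms True calculation by (simp add: cross_def)
  ultimately show thesis using that[of "fst u / fst v"] True by (simp add: lform_def)
next
  case False
  then show thesis using that[of "snd u / snd v"] assms(1) by (simp add: lform_def cross_def field_simps)
qed

text \<open>Antisymmetry of the bracket lets \<open>bracket_half\<close> be applied from both discs
  to the same quadratic form. Its root \<open>v\<close> in the disc of \<open>N\<close> is not the
  root \<open>u\<close>, because the discs are disjoint; so the leftover factor \<open>n\<close>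
  vanishes at \<open>v\<close> and is proportional to the form of \<open>v\<close>.\<close>

lemma bracket_qform:
  assumes M: "mdet M \<noteq> 0" and N: "mdet N \<noteq> 0" and MN: "mdisjoint M N"
    and z: "norm z < 1" "norm w < 1" "norm z' < 1" "norm w' < 1"
  obtains k u v where "k \<noteq> 0" "\<exists>\<nu>. norm \<nu> \<le> 1 \<and> harm z w \<nu> u" "\<exists>\<nu>. norm \<nu> \<le> 1 \<and> harm z' w' \<nu> v"
    "bracket (qform M z w) (qform N z' w') = smult k (lform (mvec M u) * lform (mvec N v))"
proof -
  obtain k u \<nu> n where 1: "k \<noteq> 0" "norm \<nu> \<le> 1" "harm z w \<nu> u"
    "bracket (qform M z w) (qform N z' w') = smult k (lform (mvec M u) * lform n)" "lform n \<noteq> 0"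
    by (rule bracket_half[OF M z(1,2) mdisjointD[OF MN _ z(3)] mdisjointD[OF MN _ z(4)]],
        assumption, assumption, rule that) (simp_all only: qform_def simp_thms)
  obtain k' v \<mu> m where 2: "k' \<noteq> 0" "norm \<mu> \<le> 1" "harm z' w' \<mu> v"
    "bracket (qform N z' w') (qform M z w) = smult k' (lform (mvec N v) * lform m)"
    by (rule bracket_half[OF N z(3,4) mdisjointD[OF mdisjoint_sym[OF MN] _ z(1)]
          mdisjointD[OF mdisjoint_sym[OF MN] _ z(2)]], assumption, assumption, rule that) (simp_all only: qform_def simp_thms)
  have uv: "norm u < 1" "norm v < 1"
    using harm_norm_le[OF 1(3,2), of "max (norm z) (norm w)"]
      harm_norm_le[OF 2(3,2), of "max (norm z') (norm w')"] z by auto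
  have "smult k (lform (mvec M u) * lform n) = smult (- k') (lform (mvec N v) * lform m)"
    using 1(4) 2(4) bracket_swap[of "qform M z w"] by (metis minus_minus smult_minus_left)
  then have "hev (smult k (lform (mvec M u) * lform n)) (mvec N v) = 0"
    by (simp only: hev_smult hev_lform cross_self mult_zero_left mult_zero_right)
  then have "cross (mvec N v) n = 0"
    using 1(1) mdisjointD[OF mdisjoint_sym[OF MN] uv(2,1)] by (simp add: hev_smult hev_lform)
  then have "cross n (mvec N v) = 0" by (simp add: cross_swap[of n])
  then obtain t where t: "lform n = smult t (lform (mvec N v))"
    using cross_eq_0D mvec_nonzero[OF N] by blast
  have eq: "bracket (qform M z w) (qform N z' w') = smult (k * t) (lform (mvec M u) * lform (mvec N v))"
    unfolding 1(4) t by simp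
  have "t \<noteq> 0" using t 1(5) by auto
  then show thesis using that[of "k * t" u v] 1 2 eq by auto
qed

lemma degree_lform: "degree (lform v) \<le> 1"
  by (simp add: lform_def)

lemma degree_qform: "degree (qform M z w) \<le> 2"
  using degree_mult_le[of "lform (mvec M z)" "lform (mvec M w)"]
    degree_lform[of "mvec M z"] degree_lform[of "mvec M w"]
  unfolding qform_def by linarith

lemma degree_2_conv:
  assumes "degree p \<le> 2"
  shows "p = [:coeff p 0, coeff p 1, coeff p 2:]"
proof (rule poly_eqI)
  fix n
  show "coeff p n = coeff [:coeff p 0, coeff p 1, coeff p 2:] n"
  proof (cases "n \<le> 2")
    case True
    then have "n = 0 \<or> n = 1 \<or> n = 2" by auto
    then show ?thesis by (auto simp: numeral_2_eq_2)
  next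
    case False
    then obtain m where "n = Suc (Suc (Suc m))"
      by (metis Suc_le_D add_2_eq_Suc' not_less_eq_eq numeral_2_eq_2)
    then show ?thesis using coeff_eq_0[of p n] assms False by simp
  qed
qed

section \<open>The determinant of three quadratic forms\<close>

lemma Delta_eq:
  "Delta p q r = coeff p 0 * coeff q 1 * coeff r 2 + coeff q 0 * coeff r 1 * coeff p 2
     + coeff r 0 * coeff p 1 * coeff q 2 - coeff p 0 * coeff r 1 * coeff q 2
     - coeff q 0 * coeff p 1 * coeff r 2 - coeff r 0 * coeff q 1 * coeff p 2"
  unfolding Delta_def det_3 by (simp add: algebra_simps)

lemma Delta_smult: "Delta (smult a p) (smult b q) (smult c r) = a * b * c * Delta p q r"
  by (simp add: Delta_eq algebra_simps)

text \<open>The identity \<open>(a \<times> b) \<times> (b \<times> c) = det(a, b, c) b\<close> of the cross product. It shows that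
  \<open>\<Delta> = 0\<close> would make the two inner brackets proportional.\<close>

lemma bracket_bracket:
  assumes "degree p \<le> 2" "degree q \<le> 2" "degree r \<le> 2"
  shows "bracket (bracket p q) (bracket q r) = smult (- 2 * Delta p q r) q"
proof -
  obtain p0 p1 p2 q0 q1 q2 r0 r1 r2 where
    [simp]: "p = [:p0, p1, p2:]" "q = [:q0, q1, q2:]" "r = [:r0, r1, r2:]"
    using assms[THEN degree_2_conv] by blast
  have D: "Delta p q r = p0 * q1 * r2 + q0 * r1 * p2 + r0 * p1 * q2
      - p0 * r1 * q2 - q0 * p1 * r2 - r0 * q1 * p2"
    unfolding Delta_eq by (simp add: numeral_2_eq_2)
  have b: "bracket [:a0, a1, a2:] [:b0, b1, b2:] =
      [:a1 * b0 - a0 * b1, 2 * (a2 * b0 - a0 * b2), a2 * b1 - a1 * b2:]"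
    for a0 a1 a2 b0 b1 b2 :: complex
    by (rule poly_eqI_eval) (simp add: bracket_def pderiv_pCons algebra_simps)
  show ?thesis unfolding D
    by (simp add: b algebra_simps)
qed

text \<open>Proportional inner brackets would have the same roots. But the first has a root
  \<open>u\<close> in the first disc, while the roots of the second lie in the other two; evaluating
  the outer bracket at \<open>u\<close> leaves one product of crosses, all non-zero by
  disjointness.\<close>

lemma Delta_qform_nonzero:
  assumes M: "mdet M1 \<noteq> 0" "mdet M2 \<noteq> 0" "mdet M3 \<noteq> 0"
    and dis: "mdisjoint M1 M2" "mdisjoint M1 M3" "mdisjoint M2 M3"
    and z: "norm z1 < 1" "norm w1 < 1" "norm z2 < 1" "norm w2 < 1" "norm z3 < 1" "norm w3 < 1"
  shows "Delta (qform M1 z1 w1) (qform M2 z2 w2) (qform M3 z3 w3) \<noteq> 0"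
proof
  assume 0: "Delta (qform M1 z1 w1) (qform M2 z2 w2) (qform M3 z3 w3) = 0"
  obtain k u v where 1: "k \<noteq> 0" "\<exists>\<nu>. norm \<nu> \<le> 1 \<and> harm z1 w1 \<nu> u" "\<exists>\<nu>. norm \<nu> \<le> 1 \<and> harm z2 w2 \<nu> v"
    "bracket (qform M1 z1 w1) (qform M2 z2 w2) = smult k (lform (mvec M1 u) * lform (mvec M2 v))"
    by (rule bracket_qform[OF M(1,2) dis(1) z(1-4)])
  obtain k' u' v' where 2: "k' \<noteq> 0" "\<exists>\<nu>. norm \<nu> \<le> 1 \<and> harm z2 w2 \<nu> u'" "\<exists>\<nu>. norm \<nu> \<le> 1 \<and> harm z3 w3 \<nu> v'"
    "bracket (qform M2 z2 w2) (qform M3 z3 w3) = smult k' (lform (mvec M2 u') * lform (mvec M3 v'))"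
    by (rule bracket_qform[OF M(2,3) dis(3) z(3-6)])
  have ball: "norm x < 1" if "\<exists>\<nu>. norm \<nu> \<le> 1 \<and> harm a b \<nu> x" "norm a < 1" "norm b < 1" for a b x
    using that harm_norm_le[of a b _ x "max (norm a) (norm b)"] by fastforce
  have uv: "norm u < 1" "norm v < 1" "norm u' < 1" "norm v' < 1"
    using ball 1 2 z by blast+
  have "bracket (smult k (lform (mvec M1 u) * lform (mvec M2 v)))
      (smult k' (lform (mvec M2 u') * lform (mvec M3 v'))) = 0"
    unfolding 1(4)[symmetric] 2(4)[symmetric] using 0
    by (subst bracket_bracket) (auto intro: degree_qform)
  then have "hev (bracket (lform (mvec M1 u) * lform (mvec M2 v))
      (lform (mvec M2 u') * lform (mvec M3 v'))) (mvec M1 u) = 0"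
    using 1(1) 2(1) by (simp add: bracket_smult)
  then show False
    using mdisjointD[OF dis(1) uv(1,3)] mdisjointD[OF dis(1) uv(1,2)] mdisjointD[OF dis(2) uv(1,4)]
    by (simp add: bracket_lform hev_add hev_smult hev_lform)
qed

section \<open>Roots on the projective line\<close>

text \<open>At \<infinity> this adds \<open>m - degree p\<close> and \<open>n - degree q\<close>;
  the degree bounds make these truncated subtractions exact.\<close>

lemma root_mult_mult:
  assumes "p \<noteq> 0" "q \<noteq> 0" "p \<in> polys_upto m" "q \<in> polys_upto n"
  shows "root_mult (m + n) (p * q) x = root_mult m p x + root_mult n q x"
  using assms
  by (auto simp: root_mult_def polys_upto_def degree_mult_eq order_mult split: option.splits)

lemma root_mult_smult: "c \<noteq> 0 \<Longrightarrow> root_mult k (smult c p) x = root_mult k p x"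
  by (auto simp: root_mult_def order_smult split: option.splits)

lemma root_mult_lform:
  assumes "v \<noteq> (0, 0)"
  shows "root_mult 1 (lform v) x = of_bool (point v = x)"
proof (cases "snd v = 0")
  case True
  then have "fst v \<noteq> 0" using assms by (metis prod.collapse)
  then show ?thesis using True
    by (cases x) (simp_all add: root_mult_def lform_def point_def order_0I)
next
  case False
  have eq: "lform v = smult (snd v) [:- (fst v / snd v), 1:]"
    using False by (simp add: lform_def)
  show ?thesis
  proof (cases x)
    case None
    then show ?thesis using False by (simp add: root_mult_def lform_def point_def)
  next
    case (Some a)
    have "order a (lform v) = order a [:- (fst v / snd v), 1:]"
      unfolding eq using False by (rule order_smult)
    also have "\<dots> = of_bool (fst v / snd v = a)"
    proof (cases "fst v / snd v = a")
      case True
      then show ?thesis using order_power_n_n[of a 1] by simp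
    next
      case 2: False
      then show ?thesis by (simp add: order_0I)
    qed
    finally show ?thesis using Some False by (simp add: root_mult_def point_def)
  qed
qed

text \<open>The fundamental theorem of algebra on the projective line: a non-zero constant has
  \<infinity> as its root.\<close>

lemma ex_root:
  assumes "p \<noteq> 0" "p \<in> polys_upto (Suc k)"
  obtains x where "root_mult (Suc k) p x > 0"
proof (cases "degree p = 0")
  case True
  then show thesis using that[of None] by (simp add: root_mult_def)
next
  case False
  then obtain a where "poly p a = 0"
    using fundamental_theorem_of_algebra[of p] by (auto simp: constant_degree)
  then show thesis using that[of "Some a"] assms(1) by (simp add: root_mult_def order_root)
qed

lemma split_root:
  assumes p: "p \<noteq> 0" "p \<in> polys_upto (Suc k)" and x: "root_mult (Suc k) p x > 0"
  obtains v p' where "v \<noteq> (0, 0)" "point v = x" "p = lform v * p'" "p' \<in> polys_upto k" "p' \<noteq> 0"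
proof (cases x)
  case None
  \<comment> \<open>The linear form of \<infinity> is the constant -1: splitting it off only changes
    the sign and lowers the degree bound.\<close>
  then show thesis
    using that[of "(1, 0)" "- p"] p x by (simp add: root_mult_def lform_def polys_upto_def point_def)
next
  case (Some a)
  then have "poly p a = 0" using x p by (simp add: root_mult_def order_root)
  then obtain p' where p': "p = [:- a, 1:] * p'" by (auto simp: poly_eq_0_iff_dvd elim: dvdE)
  then have nz: "p' \<noteq> 0" using p by auto
  have "degree p = Suc (degree p')" unfolding p' using nz by (subst degree_mult_eq) auto
  then show thesis
    using that[of "(a, 1)" p'] Some p' nz p(2) by (simp add: lform_def polys_upto_def point_def)
qed

lemma lform_in_polys_upto: "lform v \<in> polys_upto 1"
  using degree_lform by (simp add: polys_upto_def)

lemma root_mult_lform_mult: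
  assumes "v \<noteq> (0, 0)" "p \<noteq> 0" "p \<in> polys_upto k"
  shows "root_mult (Suc k) (lform v * p) x = of_bool (point v = x) + root_mult k p x"
  using root_mult_mult[of "lform v" p 1 k x] assms
  by (simp add: lform_eq_0_iff lform_in_polys_upto[unfolded One_nat_def]
      root_mult_lform[unfolded One_nat_def])

lemma finite_root_mult:
  assumes "p \<noteq> 0"
  shows "finite {x. root_mult k p x > 0}"
proof (rule finite_subset)
  show "{x. root_mult k p x > 0} \<subseteq> insert None (Some ` {a. poly p a = 0})"
  proof
    fix x assume "x \<in> {x. root_mult k p x > 0}"
    then show "x \<in> insert None (Some ` {a. poly p a = 0})"
      using assms by (cases x) (auto simp: root_mult_def order_root)
  qed
  show "finite (insert None (Some ` {a. poly p a = 0}))"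
    using assms by (simp add: poly_roots_finite)
qed

lemma num_roots_in_eq:
  assumes "p \<noteq> 0" "finite T" "{x. root_mult k p x > 0} \<subseteq> T"
  shows "num_roots_in k p S = (\<Sum>x\<in>T \<inter> S. root_mult k p x)"
  unfolding num_roots_in_def by (rule sum.mono_neutral_left) (use assms in auto)

lemma num_roots_in_lform_mult:
  assumes v: "v \<noteq> (0, 0)" and p: "p \<noteq> 0" "p \<in> polys_upto k"
  shows "num_roots_in (Suc k) (lform v * p) S = of_bool (point v \<in> S) + num_roots_in k p S"
proof -
  define T where "T = insert (point v) {x. root_mult k p x > 0}"
  have T: "finite T" unfolding T_def using finite_root_mult[OF p(1)] by simp
  have "lform v * p \<noteq> 0" using v p by (simp add: lform_eq_0_iff)
  then have "num_roots_in (Suc k) (lform v * p) S = (\<Sum>x\<in>T \<inter> S. root_mult (Suc k) (lform v * p) x)"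
    by (rule num_roots_in_eq[OF _ T]) (auto simp: root_mult_lform_mult[OF v p] T_def)
  also have "\<dots> = (\<Sum>x\<in>T \<inter> S. of_bool (point v = x)) + (\<Sum>x\<in>T \<inter> S. root_mult k p x)"
    by (simp add: root_mult_lform_mult[OF v p] sum.distrib)
  also have "(\<Sum>x\<in>T \<inter> S. root_mult k p x) = num_roots_in k p S"
    by (rule num_roots_in_eq[OF p(1) T, symmetric]) (auto simp: T_def)
  also have "(\<Sum>x\<in>T \<inter> S. of_bool (point v = x)) = (of_bool (point v \<in> S) :: nat)"
    using T by (simp add: sum.delta' of_bool_def T_def)
  finally show ?thesis .
qed

lemma split_root_in:
  assumes p: "p \<noteq> 0" "p \<in> polys_upto (Suc k)" and S: "num_roots_in (Suc k) p S > 0"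
  obtains v p' where "v \<noteq> (0, 0)" "point v \<in> S" "p = lform v * p'" "p' \<in> polys_upto k" "p' \<noteq> 0"
    "\<And>T. num_roots_in (Suc k) p T = of_bool (point v \<in> T) + num_roots_in k p' T"
proof -
  have "\<exists>x\<in>S. root_mult (Suc k) p x > 0"
    using S unfolding num_roots_in_def by (metis (no_types, lifting) empty_Collect_eq less_nat_zero_code sum.empty)
  then obtain x where "x \<in> S" "root_mult (Suc k) p x > 0" by blast
  then show thesis
    using split_root[OF p] num_roots_in_lform_mult that by metis
qed

lemma point_eq_iff:
  assumes "u \<noteq> (0, 0)" "v \<noteq> (0, 0)"
  shows "point u = point v \<longleftrightarrow> cross u v = 0"
proof -
  have "fst u \<noteq> 0 \<or> snd u \<noteq> 0" "fst v \<noteq> 0 \<or> snd v \<noteq> 0" using assms by (metis prod.collapse)+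
  then show ?thesis by (auto simp: point_def cross_def field_simps)
qed

lemma lform_eq_smult:
  assumes "u \<noteq> (0, 0)" "v \<noteq> (0, 0)" "point u = point v"
  obtains c where "c \<noteq> 0" "lform u = smult c (lform v)"
proof -
  have cr: "cross u v = 0" using assms point_eq_iff by blast
  obtain c where c: "lform u = smult c (lform v)" by (rule cross_eq_0D[OF cr assms(2)])
  have "c \<noteq> 0" using c assms(1) lform_eq_0_iff[of u] by auto
  then show thesis using c by (rule that)
qed

lemma point_mvec_mem: "norm z < 1 \<Longrightarrow> point (mvec M z) \<in> mdisc M"
  by (simp add: mdisc_def)

lemma open_disc_mdisc:
  assumes "open_disc S"
  obtains M where "mdet M \<noteq> 0" "S = mdisc M"
proof -
  obtain a b c d where 1: "a * d - b * c \<noteq> 0" "S = moebius a b c d ` Some ` ball 0 1"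
    using assms unfolding open_disc_def by blast
  have "moebius a b c d (Some z) = point (mvec ((a, c), (b, d)) z)" for z
    by (simp add: moebius_def point_def mvec_def mult.commute)
  then have "S = mdisc ((a, c), (b, d))" unfolding 1(2) mdisc_def image_image by simp
  moreover have "mdet ((a, c), (b, d)) \<noteq> 0" using 1(1) by (simp add: mdet_def cross_def mult.commute)
  ultimately show thesis using that by blast
qed

lemma mdisjoint_mdisc:
  assumes "mdet M \<noteq> 0" "mdet N \<noteq> 0" "mdisc M \<inter> mdisc N = {}"
  shows "mdisjoint M N"
  unfolding mdisjoint_def
proof (intro ballI notI)
  fix y y' assume y: "y \<in> ball 0 1" "y' \<in> ball 0 1" and "cross (mvec M y) (mvec N y') = 0"
  then have "point (mvec M y) = point (mvec N y')"
    using point_eq_iff mvec_nonzero assms by blast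
  then show False using y assms(3) point_mvec_mem[of y M] point_mvec_mem[of y' N] by auto
qed

section \<open>Quadratic forms with both roots in a disc\<close>

lemma qform_nonzero: "mdet M \<noteq> 0 \<Longrightarrow> qform M z w \<noteq> 0"
  by (simp add: qform_def lform_mvec_nonzero)

lemma qform_in_polys_upto: "qform M z w \<in> polys_upto 2"
  using degree_qform by (simp add: polys_upto_def)

lemma root_mult_qform:
  assumes "mdet M \<noteq> 0"
  shows "root_mult 2 (qform M z w) x = of_bool (point (mvec M z) = x) + of_bool (point (mvec M w) = x)"
  using root_mult_mult[of "lform (mvec M z)" "lform (mvec M w)" 1 1 x] assms
  by (simp add: qform_def lform_mvec_nonzero lform_in_polys_upto[unfolded One_nat_def] mvec_nonzero
      root_mult_lform[unfolded One_nat_def] numeral_2_eq_2)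

lemma both_roots_in_qform:
  assumes "mdet M \<noteq> 0" "norm z < 1" "norm w < 1" "c \<noteq> 0"
  shows "both_roots_in (smult c (qform M z w)) (mdisc M)"
  using assms qform_in_polys_upto[of M z w]
  by (auto simp: both_roots_in_def root_mult_smult root_mult_qform qform_nonzero polys_upto_def
      point_mvec_mem of_bool_def split: if_splits)

lemma both_roots_inE:
  assumes M: "mdet M \<noteq> 0" and p: "both_roots_in p (mdisc M)"
  obtains c z w where "c \<noteq> 0" "norm z < 1" "norm w < 1" "p = smult c (qform M z w)"
proof -
  have p': "p \<noteq> 0" "p \<in> polys_upto (Suc 1)" "\<And>x. root_mult (Suc 1) p x > 0 \<Longrightarrow> x \<in> mdisc M"
    using p by (auto simp: both_roots_in_def numeral_2_eq_2)
  obtain x where x: "root_mult (Suc 1) p x > 0" using ex_root[OF p'(1,2)] by blast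
  obtain v r where v: "v \<noteq> (0, 0)" "point v = x" "p = lform v * r" "r \<in> polys_upto 1" "r \<noteq> 0"
    by (rule split_root[OF p'(1,2) x])
  have r: "r \<in> polys_upto (Suc 0)" using v(4) by simp
  obtain y where y: "root_mult (Suc 0) r y > 0" using ex_root[OF v(5) r] by blast
  obtain u s where u: "u \<noteq> (0, 0)" "point u = y" "r = lform u * s" "s \<in> polys_upto 0" "s \<noteq> 0"
    by (rule split_root[OF v(5) r y])
  obtain a where a: "s = [:a:]" "a \<noteq> 0"
    using u(4,5) by (auto simp: polys_upto_def elim!: degree_eq_zeroE)
  have "root_mult (Suc 1) p y > 0"
    unfolding v(3) root_mult_lform_mult[OF v(1,5,4)] using y by simp
  then have xy: "x \<in> mdisc M" "y \<in> mdisc M" using p'(3) x by auto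
  then obtain z w where zw: "norm z < 1" "x = point (mvec M z)" "norm w < 1" "y = point (mvec M w)"
    unfolding mdisc_def by auto
  obtain b where b: "b \<noteq> 0" "lform v = smult b (lform (mvec M z))"
    by (rule lform_eq_smult[OF v(1) mvec_nonzero[OF M] trans[OF v(2) zw(2)]])
  obtain c where c: "c \<noteq> 0" "lform u = smult c (lform (mvec M w))"
    by (rule lform_eq_smult[OF u(1) mvec_nonzero[OF M] trans[OF u(2) zw(4)]])
  have "p = smult (a * b * c) (qform M z w)"
    unfolding v(3) u(3) a(1) b(2) c(2) qform_def by (simp add: ac_simps)
  then show thesis using a b c zw by (intro that[of "a * b * c" z w]) auto
qed

text \<open>Unordered pairs with multiplicity are compared by counting; since each pair has two
  entries, the counts at \<open>a\<close> and \<open>b\<close> suffice.\<close>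

lemma pair_eq_of_count:
  fixes a b c d :: 'a
  assumes "of_bool (a = a) + of_bool (b = a) = (of_bool (c = a) + of_bool (d = a) :: nat)"
    and "of_bool (a = b) + of_bool (b = b) = (of_bool (c = b) + of_bool (d = b) :: nat)"
  shows "a = c \<and> b = d \<or> a = d \<and> b = c"
  using assms by (cases "a = b"; cases "c = a"; cases "d = a"; cases "c = b"; cases "d = b") simp_all

section \<open>The map \<open>H\<close> on products of six linear forms\<close>

text \<open>The \<open>j\<close>-th pair holds the disc coordinates of the two roots in the
  \<open>j\<close>-th disc. The index type \<open>3\<close> consists of 1, 2 and 3, the last being
  equal to 0.\<close>

definition inside :: "(3 \<Rightarrow> complex \<times> complex) \<Rightarrow> bool" where
  "inside p \<longleftrightarrow> (\<forall>j. norm (fst (p j)) < 1 \<and> norm (snd (p j)) < 1)"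

locale three_discs =
  fixes M :: "3 \<Rightarrow> hvec \<times> hvec"
  assumes det: "mdet (M j) \<noteq> 0"
    and disj: "i \<noteq> j \<Longrightarrow> mdisjoint (M i) (M j)"
begin

definition discs :: cp1_triple where
  "discs = (mdisc (M 1), mdisc (M 2), mdisc (M 3))"

definition q :: "(3 \<Rightarrow> complex \<times> complex) \<Rightarrow> 3 \<Rightarrow> complex poly" where
  "q p j = qform (M j) (fst (p j)) (snd (p j))"

definition sextic :: "(3 \<Rightarrow> complex \<times> complex) \<Rightarrow> complex poly" where
  "sextic p = q p 1 * q p 2 * q p 3"

lemma q_nonzero: "q p j \<noteq> 0"
  by (simp add: q_def qform_nonzero det)

lemma sextic_nonzero: "sextic p \<noteq> 0"
  by (simp add: sextic_def q_nonzero)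

lemma degree_sextic: "degree (sextic p) \<le> 6"
proof -
  have "degree (q p j) \<le> 2" for j unfolding q_def by (rule degree_qform)
  from this[of 1] this[of 2] this[of 3] show ?thesis
    unfolding sextic_def using degree_mult_le[of "q p 1 * q p 2" "q p 3"] degree_mult_le[of "q p 1" "q p 2"]
    by linarith
qed

lemma root_mult_sextic:
  assumes "c \<noteq> 0"
  shows "root_mult 6 (smult c (sextic p)) x =
    (\<Sum>j\<in>UNIV. of_bool (point (mvec (M j) (fst (p j))) = x) + of_bool (point (mvec (M j) (snd (p j))) = x))"
proof -
  have q: "q p j \<in> polys_upto 2" for j unfolding q_def by (rule qform_in_polys_upto)
  have 4: "q p 1 * q p 2 \<in> polys_upto (2 + 2)"
    using q[of 1] q[of 2] degree_mult_le[of "q p 1" "q p 2"] unfolding polys_upto_def mem_Collect_eq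
    by linarith
  have "root_mult 6 (smult c (sextic p)) x = root_mult ((2 + 2) + 2) (sextic p) x"
    using assms by (simp add: root_mult_smult)
  also have "\<dots> = root_mult 2 (q p 1) x + root_mult 2 (q p 2) x + root_mult 2 (q p 3) x"
  proof -
    have "root_mult (2 + 2 + 2) (sextic p) x = root_mult (2 + 2) (q p 1 * q p 2) x + root_mult 2 (q p 3) x"
      unfolding sextic_def by (rule root_mult_mult[OF _ q_nonzero 4 q]) (simp add: q_nonzero)
    moreover have "root_mult (2 + 2) (q p 1 * q p 2) x = root_mult 2 (q p 1) x + root_mult 2 (q p 2) x"
      by (rule root_mult_mult[OF q_nonzero q_nonzero q q])
    ultimately show ?thesis by linarith
  qed
  also have "\<dots> = (\<Sum>j\<in>UNIV. root_mult 2 (q p j) x)" by (simp only: sum_3)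
  finally show ?thesis unfolding q_def by (simp only: root_mult_qform[OF det])
qed

lemma point_mvec_eq_iff:
  assumes "norm y < 1" "norm y' < 1"
  shows "point (mvec (M i) y) = point (mvec (M j) y') \<longleftrightarrow> i = j \<and> y = y'"
proof (cases "i = j")
  case True
  then show ?thesis by (simp add: point_eq_iff mvec_nonzero det cross_mvec)
next
  case False
  then show ?thesis using mdisjointD[OF disj[OF False] assms]
    by (simp add: point_eq_iff mvec_nonzero det)
qed

lemma root_mult_sextic_inside:
  assumes p: "inside p" and c: "c \<noteq> 0" and y: "norm y < 1"
  shows "root_mult 6 (smult c (sextic p)) (point (mvec (M j) y)) =
    of_bool (fst (p j) = y) + of_bool (snd (p j) = y)"
proof -
  have "root_mult 6 (smult c (sextic p)) (point (mvec (M j) y)) =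
     (\<Sum>i\<in>UNIV. if i = j then of_bool (fst (p i) = y) + of_bool (snd (p i) = y) else 0)"
    unfolding root_mult_sextic[OF c]
    by (rule sum.cong) (use p y in \<open>auto simp: point_mvec_eq_iff inside_def\<close>)
  then show ?thesis by simp
qed

text \<open>The discs are disjoint, so multiplicities at points of the \<open>j\<close>-th disc
  recover the pair \<open>p j\<close> up to order, and \<open>q\<close> is symmetric in the pair. As
  \<open>q\<close> has no free scalar, the constants agree too.\<close>

lemma sextic_unique:
  assumes "inside p" "inside p'" "c \<noteq> 0" "c' \<noteq> 0"
    and eq: "smult c (sextic p) = smult c' (sextic p')"
  shows "q p j = q p' j" "c = c'"
proof -
  show *: "q p j = q p' j" for j
  proof -
    have *: "of_bool (fst (p j) = y) + of_bool (snd (p j) = y) =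
        (of_bool (fst (p' j) = y) + of_bool (snd (p' j) = y) :: nat)" if "norm y < 1" for y
      using root_mult_sextic_inside[OF assms(1,3) that, of j]
        root_mult_sextic_inside[OF assms(2,4) that, of j] eq by simp
    have "norm (fst (p j)) < 1" "norm (snd (p j)) < 1" using assms(1) by (auto simp: inside_def)
    then have "fst (p j) = fst (p' j) \<and> snd (p j) = snd (p' j) \<or> fst (p j) = snd (p' j) \<and> snd (p j) = fst (p' j)"
      using *[of "fst (p j)"] *[of "snd (p j)"] by (intro pair_eq_of_count) auto
    then show ?thesis by (auto simp: q_def qform_def mult.commute)
  qed
  have "sextic p = sextic p'" by (simp add: sextic_def *)
  then have "smult (c - c') (sextic p) = 0" using eq by (simp add: smult_diff_left)
  then show "c = c'" using sextic_nonzero by simp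
qed

lemma factorization_sextic:
  assumes p: "inside p" and c: "c \<noteq> 0"
  shows "factorization discs (smult c (sextic p)) (smult c (q p 1), q p 2, q p 3)"
proof -
  have "both_roots_in (smult a (q p j)) (mdisc (M j))" if "a \<noteq> 0" for a j
    unfolding q_def by (rule both_roots_in_qform) (use p that det in \<open>auto simp: inside_def\<close>)
  from this[of c 1] this[of 1 2] this[of 1 3] show ?thesis
    using c by (simp add: factorization_def discs_def sextic_def)
qed

lemma factorization_sextic_unique:
  assumes p: "inside p" and c: "c \<noteq> 0" and f: "factorization discs (smult c (sextic p)) (p1, p2, p3)"
  obtains c1 c2 c3 where "c = c1 * c2 * c3" "p1 = smult c1 (q p 1)" "p2 = smult c2 (q p 2)" "p3 = smult c3 (q p 3)"
proof -
  have f': "smult c (sextic p) = p1 * p2 * p3" "both_roots_in p1 (mdisc (M 1))"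
    "both_roots_in p2 (mdisc (M 2))" "both_roots_in p3 (mdisc (M 3))"
    using f by (auto simp: factorization_def discs_def)
  obtain c1 z1 w1 where 1: "c1 \<noteq> 0" "norm z1 < 1" "norm w1 < 1" "p1 = smult c1 (qform (M 1) z1 w1)"
    by (rule both_roots_inE[OF det f'(2)])
  obtain c2 z2 w2 where 2: "c2 \<noteq> 0" "norm z2 < 1" "norm w2 < 1" "p2 = smult c2 (qform (M 2) z2 w2)"
    by (rule both_roots_inE[OF det f'(3)])
  obtain c3 z3 w3 where 3: "c3 \<noteq> 0" "norm z3 < 1" "norm w3 < 1" "p3 = smult c3 (qform (M 3) z3 w3)"
    by (rule both_roots_inE[OF det f'(4)])
  define p' :: "3 \<Rightarrow> complex \<times> complex" where
    "p' j = (if j = 1 then (z1, w1) else if j = 2 then (z2, w2) else (z3, w3))" for j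
  have in': "inside p'" using 1 2 3 by (simp add: inside_def p'_def)
  have q': "q p' 1 = qform (M 1) z1 w1" "q p' 2 = qform (M 2) z2 w2" "q p' 3 = qform (M 3) z3 w3"
    by (simp_all add: q_def p'_def)
  have "smult c (sextic p) = smult (c1 * c2 * c3) (sextic p')"
    unfolding f'(1) by (simp add: sextic_def q' 1(4) 2(4) 3(4) ac_simps)
  note u = sextic_unique[OF p in' c _ this]
  show thesis
    by (rule that[of c1 c2 c3]) (use u 1 2 3 q' in auto)
qed

text \<open>Removes the choice of a factorization from \<open>H\<close>. Rescaling the factors by
  \<open>c1\<close>, \<open>c2\<close>, \<open>c3\<close> multiplies the product of brackets by
  \<open>(c1 * c2 * c3)^2\<close> and \<open>Delta\<close> by \<open>c1 * c2 * c3\<close>, so only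
  \<open>c = c1 * c2 * c3\<close> remains.\<close>

lemma H_sextic:
  assumes p: "inside p" and c: "c \<noteq> 0"
  shows "H discs (smult c (sextic p)) = smult (c / (4 * Delta (q p 1) (q p 2) (q p 3)))
     (bracket (q p 2) (q p 3) * bracket (q p 3) (q p 1) * bracket (q p 1) (q p 2))"
proof -
  obtain p1 p2 p3 where ps: "(SOME ps. factorization discs (smult c (sextic p)) ps) = (p1, p2, p3)"
    by (metis prod_cases3)
  have "factorization discs (smult c (sextic p)) (p1, p2, p3)"
    using someI[of "factorization discs (smult c (sextic p))", OF factorization_sextic[OF p c]] unfolding ps .
  then obtain c1 c2 c3 where
    *: "c = c1 * c2 * c3" "p1 = smult c1 (q p 1)" "p2 = smult c2 (q p 2)" "p3 = smult c3 (q p 3)"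
    by (rule factorization_sextic_unique[OF p c])
  have nz: "c1 \<noteq> 0" "c2 \<noteq> 0" "c3 \<noteq> 0" using c * by auto
  have scal: "1 / (4 * (c1 * c2 * c3 * d)) * ((c2 * c3) * ((c3 * c1) * (c1 * c2))) = c / (4 * d)" for d
    using nz unfolding *(1) by (cases "d = 0") (simp_all add: field_simps)
  have smult3: "smult s (smult a X * smult b Y * smult e Z) = smult (s * (a * (b * e))) (X * Y * Z)"
    for s a b e and X Y Z :: "complex poly"
    by (simp add: ac_simps)
  have "H discs (smult c (sextic p)) =
      smult (1 / (4 * Delta p1 p2 p3)) (bracket p2 p3 * bracket p3 p1 * bracket p1 p2)"
    unfolding H_def ps by simp
  then show ?thesis unfolding *(2-4) bracket_smult Delta_smult smult3 scal .
qed

lemma Delta_q_nonzero: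
  assumes "inside p"
  shows "Delta (q p 1) (q p 2) (q p 3) \<noteq> 0"
  unfolding q_def using assms by (intro Delta_qform_nonzero det disj) (auto simp: inside_def)

lemma harm_inside:
  assumes "inside p" "\<exists>\<nu>. norm \<nu> \<le> 1 \<and> harm (fst (p j)) (snd (p j)) \<nu> u"
  shows "norm u < 1"
proof -
  obtain \<nu> where \<nu>: "norm \<nu> \<le> 1" "harm (fst (p j)) (snd (p j)) \<nu> u" using assms(2) by blast
  have lt: "max (norm (fst (p j))) (norm (snd (p j))) < 1" using assms(1) by (simp add: inside_def)
  have "norm u \<le> max (norm (fst (p j))) (norm (snd (p j)))"
    by (rule harm_norm_le[OF \<nu>(2,1) _ _ lt]) auto
  then show ?thesis using lt by linarith
qed

lemma H_sextic_step:
  assumes p: "inside p" and c: "c \<noteq> 0"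
  obtains c' p' where "c' \<noteq> 0" "inside p'" "H discs (smult c (sextic p)) = smult c' (sextic p')"
    "\<And>j. \<exists>\<nu>. norm \<nu> \<le> 1 \<and> harm (fst (p j)) (snd (p j)) \<nu> (fst (p' j))"
    "\<And>j. \<exists>\<nu>. norm \<nu> \<le> 1 \<and> harm (fst (p j)) (snd (p j)) \<nu> (snd (p' j))"
proof -
  have b: "norm (fst (p j)) < 1" "norm (snd (p j)) < 1" for j using p by (auto simp: inside_def)
  have d12: "mdisjoint (M 1) (M 2)" and d23: "mdisjoint (M 2) (M 3)" and d31: "mdisjoint (M 3) (M 1)"
    by (auto intro!: disj)
  obtain k12 u12 u21 where 1: "k12 \<noteq> 0"
    "\<exists>\<nu>. norm \<nu> \<le> 1 \<and> harm (fst (p 1)) (snd (p 1)) \<nu> u12"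
    "\<exists>\<nu>. norm \<nu> \<le> 1 \<and> harm (fst (p 2)) (snd (p 2)) \<nu> u21"
    "bracket (q p 1) (q p 2) = smult k12 (lform (mvec (M 1) u12) * lform (mvec (M 2) u21))"
    unfolding q_def by (rule bracket_qform[OF det det d12 b(1,2) b(1,2)])
  obtain k23 u23 u32 where 2: "k23 \<noteq> 0"
    "\<exists>\<nu>. norm \<nu> \<le> 1 \<and> harm (fst (p 2)) (snd (p 2)) \<nu> u23"
    "\<exists>\<nu>. norm \<nu> \<le> 1 \<and> harm (fst (p 3)) (snd (p 3)) \<nu> u32"
    "bracket (q p 2) (q p 3) = smult k23 (lform (mvec (M 2) u23) * lform (mvec (M 3) u32))"
    unfolding q_def by (rule bracket_qform[OF det det d23 b(1,2) b(1,2)])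
  obtain k31 u31 u13 where 3: "k31 \<noteq> 0"
    "\<exists>\<nu>. norm \<nu> \<le> 1 \<and> harm (fst (p 3)) (snd (p 3)) \<nu> u31"
    "\<exists>\<nu>. norm \<nu> \<le> 1 \<and> harm (fst (p 1)) (snd (p 1)) \<nu> u13"
    "bracket (q p 3) (q p 1) = smult k31 (lform (mvec (M 3) u31) * lform (mvec (M 1) u13))"
    unfolding q_def by (rule bracket_qform[OF det det d31 b(1,2) b(1,2)])
  \<comment> \<open>Each disc receives one root from each of the two brackets that involve its
    quadratic form.\<close>
  define p' :: "3 \<Rightarrow> complex \<times> complex" where
    "p' j = (if j = 1 then (u12, u13) else if j = 2 then (u21, u23) else (u31, u32))" for j
  define c' where "c' = c / (4 * Delta (q p 1) (q p 2) (q p 3)) * (k12 * k23 * k31)"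
  have c': "c' \<noteq> 0" using c 1 2 3 Delta_q_nonzero[OF p] by (simp add: c'_def)
  have fst': "\<exists>\<nu>. norm \<nu> \<le> 1 \<and> harm (fst (p j)) (snd (p j)) \<nu> (fst (p' j))" for j
    using exhaust_3[of j] 1 2 3 by (auto simp: p'_def)
  have snd': "\<exists>\<nu>. norm \<nu> \<le> 1 \<and> harm (fst (p j)) (snd (p j)) \<nu> (snd (p' j))" for j
    using exhaust_3[of j] 1 2 3 by (auto simp: p'_def)
  have in': "inside p'" unfolding inside_def using harm_inside[OF p fst'] harm_inside[OF p snd'] by blast
  have q': "q p' 1 = lform (mvec (M 1) u12) * lform (mvec (M 1) u13)"
    "q p' 2 = lform (mvec (M 2) u21) * lform (mvec (M 2) u23)"
    "q p' 3 = lform (mvec (M 3) u31) * lform (mvec (M 3) u32)"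
    by (simp_all add: q_def qform_def p'_def)
  have "H discs (smult c (sextic p)) = smult c' (sextic p')"
    unfolding H_sextic[OF p c] sextic_def[of p'] q' 1(4) 2(4) 3(4) c'_def by (simp add: ac_simps)
  then show thesis using that c' in' fst' snd' by blast
qed

lemma sextic_of_points:
  assumes "v 1 \<noteq> (0, 0)" "v 2 \<noteq> (0, 0)" "v 3 \<noteq> (0, 0)" "u 1 \<noteq> (0, 0)" "u 2 \<noteq> (0, 0)" "u 3 \<noteq> (0, 0)"
    and "\<And>j::3. point (v j) \<in> mdisc (M j)" "\<And>j. point (u j) \<in> mdisc (M j)"
  obtains c p where "c \<noteq> 0" "inside p"
    "lform (v 1) * lform (u 1) * (lform (v 2) * lform (u 2)) * (lform (v 3) * lform (u 3)) = smult c (sextic p)"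
proof -
  have nz: "v j \<noteq> (0, 0)" "u j \<noteq> (0, 0)" for j using assms(1-6) exhaust_3[of j] by auto
  have "\<exists>z c. norm z < 1 \<and> c \<noteq> 0 \<and> lform (v j) = smult c (lform (mvec (M j) z))" for j
  proof -
    obtain z where z: "norm z < 1" "point (v j) = point (mvec (M j) z)"
      using assms(7)[of j] unfolding mdisc_def by auto
    show ?thesis
      by (rule lform_eq_smult[OF nz(1) mvec_nonzero[OF det] z(2)]) (use z(1) in blast)
  qed
  then obtain z c where z: "\<And>j. norm (z j) < 1 \<and> c j \<noteq> 0 \<and> lform (v j) = smult (c j) (lform (mvec (M j) (z j)))"
    by metis
  have "\<exists>z c. norm z < 1 \<and> c \<noteq> 0 \<and> lform (u j) = smult c (lform (mvec (M j) z))" for j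
  proof -
    obtain z where z: "norm z < 1" "point (u j) = point (mvec (M j) z)"
      using assms(8)[of j] unfolding mdisc_def by auto
    show ?thesis
      by (rule lform_eq_smult[OF nz(2) mvec_nonzero[OF det] z(2)]) (use z(1) in blast)
  qed
  then obtain w d where w: "\<And>j. norm (w j) < 1 \<and> d j \<noteq> 0 \<and> lform (u j) = smult (d j) (lform (mvec (M j) (w j)))"
    by metis
  define k where "k = c 1 * d 1 * c 2 * d 2 * (c 3 * d 3)"
  have "k \<noteq> 0" using z w by (simp add: k_def)
  moreover have "inside (\<lambda>j. (z j, w j))" using z w by (simp add: inside_def)
  moreover have "lform (v 1) * lform (u 1) * (lform (v 2) * lform (u 2)) * (lform (v 3) * lform (u 3))
      = smult k (sextic (\<lambda>j. (z j, w j)))"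
    unfolding z[THEN conjunct2, THEN conjunct2] w[THEN conjunct2, THEN conjunct2] sextic_def q_def qform_def k_def
    by (simp add: ac_simps)
  ultimately show thesis by (rule that)
qed

text \<open>Six roots are split off, two per disc. A root in one disc does not affect the counts in
  the others, and after six steps the degree bound 0 leaves a constant.\<close>

lemma subordinate_sextic:
  assumes "subordinate f discs"
  obtains c p where "c \<noteq> 0" "inside p" "f = smult c (sextic p)"
proof -
  let ?D = "\<lambda>j. mdisc (M j)"
  have f: "f \<noteq> 0" "f \<in> polys_upto (Suc 5)" "num_roots_in (Suc 5) f (?D 1) = 2"
     "num_roots_in (Suc 5) f (?D 2) = 2" "num_roots_in (Suc 5) f (?D 3) = 2"
    using assms by (auto simp: subordinate_def discs_def)
  have excl: "x \<notin> ?D j" if "x \<in> ?D i" "i \<noteq> j" for x i j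
    using that point_mvec_eq_iff unfolding mdisc_def by fastforce
  obtain v1 f1 where 1: "v1 \<noteq> (0, 0)" "point v1 \<in> ?D 1" "f = lform v1 * f1" "f1 \<in> polys_upto 5" "f1 \<noteq> 0"
    "\<And>T. num_roots_in (Suc 5) f T = of_bool (point v1 \<in> T) + num_roots_in 5 f1 T"
    by (rule split_root_in[OF f(1,2), of "?D 1"]) (use f in auto)
  have f1: "f1 \<in> polys_upto (Suc 4)" "num_roots_in (Suc 4) f1 (?D 1) = 1"
     "num_roots_in (Suc 4) f1 (?D 2) = 2" "num_roots_in (Suc 4) f1 (?D 3) = 2"
    using f 1(4) 1(6)[of "?D 1"] 1(6)[of "?D 2"] 1(6)[of "?D 3"] 1(2) excl[OF 1(2)] by auto
  obtain u1 f2 where 2: "u1 \<noteq> (0, 0)" "point u1 \<in> ?D 1" "f1 = lform u1 * f2" "f2 \<in> polys_upto 4" "f2 \<noteq> 0"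
    "\<And>T. num_roots_in (Suc 4) f1 T = of_bool (point u1 \<in> T) + num_roots_in 4 f2 T"
    by (rule split_root_in[OF 1(5) f1(1), of "?D 1"]) (use f1 in auto)
  have f2: "f2 \<in> polys_upto (Suc 3)"
     "num_roots_in (Suc 3) f2 (?D 2) = 2" "num_roots_in (Suc 3) f2 (?D 3) = 2"
    using f1 2(4) 2(6)[of "?D 2"] 2(6)[of "?D 3"] excl[OF 2(2)] by auto
  obtain v2 f3 where 3: "v2 \<noteq> (0, 0)" "point v2 \<in> ?D 2" "f2 = lform v2 * f3" "f3 \<in> polys_upto 3" "f3 \<noteq> 0"
    "\<And>T. num_roots_in (Suc 3) f2 T = of_bool (point v2 \<in> T) + num_roots_in 3 f3 T"
    by (rule split_root_in[OF 2(5) f2(1), of "?D 2"]) (use f2 in auto)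
  have f3: "f3 \<in> polys_upto (Suc 2)"
     "num_roots_in (Suc 2) f3 (?D 2) = 1" "num_roots_in (Suc 2) f3 (?D 3) = 2"
    using f2 3(4) 3(6)[of "?D 2"] 3(6)[of "?D 3"] 3(2) excl[OF 3(2)] by auto
  obtain u2 f4 where 4: "u2 \<noteq> (0, 0)" "point u2 \<in> ?D 2" "f3 = lform u2 * f4" "f4 \<in> polys_upto 2" "f4 \<noteq> 0"
    "\<And>T. num_roots_in (Suc 2) f3 T = of_bool (point u2 \<in> T) + num_roots_in 2 f4 T"
    by (rule split_root_in[OF 3(5) f3(1), of "?D 2"]) (use f3 in auto)
  have f4: "f4 \<in> polys_upto (Suc 1)" "num_roots_in (Suc 1) f4 (?D 3) = 2"
    using f3 4(4) 4(6)[of "?D 3"] excl[OF 4(2)] by (auto simp: numeral_2_eq_2)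
  obtain v3 f5 where 5: "v3 \<noteq> (0, 0)" "point v3 \<in> ?D 3" "f4 = lform v3 * f5" "f5 \<in> polys_upto 1" "f5 \<noteq> 0"
    "\<And>T. num_roots_in (Suc 1) f4 T = of_bool (point v3 \<in> T) + num_roots_in 1 f5 T"
    by (rule split_root_in[OF 4(5) f4(1), of "?D 3"]) (use f4 in auto)
  have f5: "f5 \<in> polys_upto (Suc 0)" "num_roots_in (Suc 0) f5 (?D 3) = 1"
    using f4 5(4) 5(6)[of "?D 3"] 5(2) by auto
  obtain u3 f6 where 6: "u3 \<noteq> (0, 0)" "point u3 \<in> ?D 3" "f5 = lform u3 * f6" "f6 \<in> polys_upto 0" "f6 \<noteq> 0"
    "\<And>T. num_roots_in (Suc 0) f5 T = of_bool (point u3 \<in> T) + num_roots_in 0 f6 T"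
    by (rule split_root_in[OF 5(5) f5(1), of "?D 3"]) (use f5 in auto)
  obtain a where a: "f6 = [:a:]" "a \<noteq> 0"
    using 6(4,5) by (auto simp: polys_upto_def elim!: degree_eq_zeroE)
  define v :: "3 \<Rightarrow> hvec" where "v j = (if j = 1 then v1 else if j = 2 then v2 else v3)" for j
  define u :: "3 \<Rightarrow> hvec" where "u j = (if j = 1 then u1 else if j = 2 then u2 else u3)" for j
  have mem: "point (v j) \<in> mdisc (M j)" "point (u j) \<in> mdisc (M j)" for j
    using exhaust_3[of j] 1(2) 2(2) 3(2) 4(2) 5(2) 6(2) by (auto simp: v_def u_def)
  obtain c p where cp: "c \<noteq> 0" "inside p"
    "lform (v 1) * lform (u 1) * (lform (v 2) * lform (u 2)) * (lform (v 3) * lform (u 3)) = smult c (sextic p)"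
    by (rule sextic_of_points[of v u, OF _ _ _ _ _ _ mem]) (use 1 2 3 4 5 6 in \<open>auto simp: v_def u_def\<close>)
  have "f = smult a (lform (v 1) * lform (u 1) * (lform (v 2) * lform (u 2)) * (lform (v 3) * lform (u 3)))"
    unfolding 1(3) 2(3) 3(3) 4(3) 5(3) 6(3) a(1) by (simp add: v_def u_def ac_simps)
  then have "f = smult (a * c) (sextic p)" unfolding cp(3) by simp
  then show thesis using cp a by (intro that[of "a * c" p]) auto
qed

lemma double_root_sextic:
  assumes l: "\<And>j. norm (l j) < 1" and c: "c \<noteq> 0"
  shows "double_root_in_each (smult c (sextic (\<lambda>j. (l j, l j)))) discs"
proof -
  let ?P = "\<lambda>j. point (mvec (M j) (l j))"
  have mult: "root_mult 6 (smult c (sextic (\<lambda>j. (l j, l j)))) x = (\<Sum>j\<in>UNIV. 2 * of_bool (?P j = x))" for x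
    unfolding root_mult_sextic[OF c] by (rule sum.cong) auto
  have ne: "?P i = ?P j \<longleftrightarrow> i = j" for i j
    using point_mvec_eq_iff[OF l l] by auto
  have "{x. root_mult 6 (smult c (sextic (\<lambda>j. (l j, l j)))) x = 2} = {?P 1, ?P 2, ?P 3}"
    unfolding mult sum_3 by (auto simp: ne of_bool_def split: if_splits)
  moreover have "?P j \<in> mdisc (M j)" for j using l by (rule point_mvec_mem)
  moreover have "smult c (sextic (\<lambda>j. (l j, l j))) \<in> polys_upto 6"
    using degree_sextic c by (simp add: polys_upto_def)
  ultimately show ?thesis
    using c sextic_nonzero ne[of 1 2] ne[of 1 3] ne[of 2 3] unfolding double_root_in_each_def discs_def prod.case
    by (intro conjI bexI[of _ "?P 1"] bexI[of _ "?P 2"] bexI[of _ "?P 3"]) simp_all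
qed

end

section \<open>Convergence of the iterates\<close>

lemma qconv_sum:
  assumes "finite I" "\<And>i. i \<in> I \<Longrightarrow> qconv q (\<lambda>n. x n i) (l i)"
  shows "qconv q (\<lambda>n. \<Sum>i\<in>I. x n i) (\<Sum>i\<in>I. l i)"
  using assms
proof (induction I rule: finite_induct)
  case (insert i I)
  have "qconv q (\<lambda>n. x n i + (\<Sum>i\<in>I. x n i)) (l i + (\<Sum>i\<in>I. l i))"
    by (rule qconv_add) (use insert in auto)
  then show ?case using insert.hyps by simp
qed simp

text \<open>All coefficients are required to converge, with no degree bound, so that products and
  derivatives need no side conditions.\<close>

definition pconv :: "real \<Rightarrow> (nat \<Rightarrow> complex poly) \<Rightarrow> complex poly \<Rightarrow> bool" where
  "pconv q P L \<longleftrightarrow> (\<forall>i. qconv q (\<lambda>n. coeff (P n) i) (coeff L i))"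

lemma pconvD: "pconv q P L \<Longrightarrow> qconv q (\<lambda>n. coeff (P n) i) (coeff L i)"
  by (simp add: pconv_def)

section \<open>Algebraic operations on quadratically convergent polynomials\<close>

context
  fixes q :: real
  assumes q: "0 < q" "q < 1"
begin

lemma pconv_mult:
  assumes "pconv q P L" "pconv q P' L'"
  shows "pconv q (\<lambda>n. P n * P' n) (L * L')"
  unfolding pconv_def coeff_mult
  by (intro allI qconv_sum[OF finite_atMost] qconv_mult[OF q] pconvD[OF assms(1)] pconvD[OF assms(2)])

lemma pconv_diff:
  assumes "pconv q P L" "pconv q P' L'"
  shows "pconv q (\<lambda>n. P n - P' n) (L - L')"
  unfolding pconv_def coeff_diff
  by (intro allI qconv_diff[OF q] pconvD[OF assms(1)] pconvD[OF assms(2)])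

lemma pconv_pderiv:
  assumes "pconv q P L"
  shows "pconv q (\<lambda>n. pderiv (P n)) (pderiv L)"
  unfolding pconv_def coeff_pderiv
  by (intro allI qconv_mult[OF q] qconv_const pconvD[OF assms])

lemma pconv_smult:
  assumes "qconv q c a" "pconv q P L"
  shows "pconv q (\<lambda>n. smult (c n) (P n)) (smult a L)"
  unfolding pconv_def coeff_smult
  by (intro allI qconv_mult[OF q] assms(1) pconvD[OF assms(2)])

lemma pconv_bracket:
  assumes "pconv q P L" "pconv q P' L'"
  shows "pconv q (\<lambda>n. bracket (P n) (P' n)) (bracket L L')"
  unfolding bracket_def by (intro pconv_diff pconv_mult pconv_pderiv assms)

lemma qconv_Delta:
  assumes "pconv q P1 L1" "pconv q P2 L2" "pconv q P3 L3"
  shows "qconv q (\<lambda>n. Delta (P1 n) (P2 n) (P3 n)) (Delta L1 L2 L3)"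
  unfolding Delta_eq
  by (intro qconv_diff[OF q] qconv_add qconv_mult[OF q] assms[THEN pconvD])

lemma pconv_lform_mvec:
  assumes "qconv q z l"
  shows "pconv q (\<lambda>n. lform (mvec M (z n))) (lform (mvec M l))"
proof -
  have eq: "coeff (lform (mvec M z)) i = z * coeff (lform (fst M)) i + coeff (lform (snd M)) i" for z i
    unfolding lform_def mvec_def by (simp add: coeff_pCons algebra_simps split: nat.split)
  show ?thesis unfolding pconv_def eq
    by (intro allI qconv_add qconv_mult[OF q] qconv_const assms)
qed

lemma pconv_qform:
  assumes "qconv q z l" "qconv q w m"
  shows "pconv q (\<lambda>n. qform M (z n) (w n)) (qform M l m)"
  unfolding qform_def by (intro pconv_mult pconv_lform_mvec assms)

text \<open>Any norm is at most the sum of \<open>|coeff h i| * N (monom 1 i)\<close>. The induction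
  carries membership in \<open>polys_upto k\<close> along because the norm axioms are available only
  there.\<close>

lemma pconv_imp_converges_quadratically:
  assumes N: "norm_on_polys k N" and F: "\<And>n. F n \<in> polys_upto k" and g: "g \<in> polys_upto k"
    and conv: "pconv q F g"
  shows "converges_quadratically_to N F g"
proof -
  have N0: "0 \<le> N h" if "h \<in> polys_upto k" for h
    using N that by (simp add: norm_on_polys_def)
  have Nadd: "N (h + h') \<le> N h + N h'" if "h \<in> polys_upto k" "h' \<in> polys_upto k" for h h'
    using N that by (simp add: norm_on_polys_def)
  have Nmonom: "N (monom a i) = norm a * N (monom 1 i)" if "i \<le> k" for a i
  proof -
    have "monom (1::complex) i \<in> polys_upto k"
      using that degree_monom_le[of "1::complex" i] by (simp add: polys_upto_def)
    then have "N (smult a (monom 1 i)) = norm a * N (monom 1 i)"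
      using N by (simp add: norm_on_polys_def)
    then show ?thesis by (simp add: smult_monom)
  qed
  have mono: "monom a i \<in> polys_upto k" if "i \<le> k" for a i
    using that order_trans[OF degree_monom_le] by (auto simp: polys_upto_def)
  have zero: "N 0 = 0" using N by (simp add: norm_on_polys_def polys_upto_def)
  have sums: "(\<Sum>i\<in>I. monom (a i) i) \<in> polys_upto k \<and>
      N (\<Sum>i\<in>I. monom (a i) i) \<le> (\<Sum>i\<in>I. norm (a i) * N (monom 1 i))"
    if "finite I" "I \<subseteq> {..k}" for I a
    using that
  proof (induction I rule: finite_induct)
    case empty
    then show ?case using zero by (simp add: polys_upto_def)
  next
    case (insert i I)
    then have IH: "(\<Sum>i\<in>I. monom (a i) i) \<in> polys_upto k"
      "N (\<Sum>i\<in>I. monom (a i) i) \<le> (\<Sum>i\<in>I. norm (a i) * N (monom 1 i))" and i: "i \<le> k" by auto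
    have "monom (a i) i + (\<Sum>i\<in>I. monom (a i) i) \<in> polys_upto k"
      using mono[OF i] IH(1) by (simp add: polys_upto_def degree_add_le)
    moreover have "N (monom (a i) i + (\<Sum>i\<in>I. monom (a i) i))
        \<le> norm (a i) * N (monom 1 i) + (\<Sum>i\<in>I. norm (a i) * N (monom 1 i))"
      using Nadd[OF mono[OF i, of "a i"] IH(1)] IH(2) Nmonom[OF i, of "a i"] by linarith
    ultimately show ?case using insert.hyps by simp
  qed
  have "\<exists>C. \<forall>n. norm (coeff (F n) i - coeff g i) \<le> C * q ^ 2 ^ n" for i
    using pconvD[OF conv] by (simp add: qconv_def)
  then obtain C where C: "\<And>i n. norm (coeff (F n) i - coeff g i) \<le> C i * q ^ 2 ^ n" by metis
  define K where "K = (\<Sum>i\<le>k. C i * N (monom 1 i))"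
  have diff: "F n - g \<in> polys_upto k" for n
    using F[of n] g by (simp add: polys_upto_def degree_diff_le)
  have le: "N (F n - g) \<le> K * q ^ 2 ^ n" for n
  proof -
    have "F n - g = (\<Sum>i\<le>k. monom (coeff (F n - g) i) i)"
      using diff[of n] by (intro poly_as_sum_of_monoms'[symmetric]) (simp add: polys_upto_def)
    then have "N (F n - g) \<le> (\<Sum>i\<le>k. norm (coeff (F n - g) i) * N (monom 1 i))"
      using sums[of "{..k}" "coeff (F n - g)"] by (metis finite_atMost order_refl)
    also have "\<dots> \<le> (\<Sum>i\<le>k. C i * q ^ 2 ^ n * N (monom 1 i))"
      using C N0 mono by (intro sum_mono mult_right_mono) auto
    also have "\<dots> = K * q ^ 2 ^ n" unfolding K_def sum_distrib_right by (rule sum.cong) auto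
    finally show ?thesis .
  qed
  \<comment> \<open>Chosen so that \<open>exp (- d * 2 ^ n) = q ^ 2 ^ n\<close>; it is positive
    because \<open>q < 1\<close>.\<close>
  define d where "d = - ln q"
  have d: "d > 0" using q by (simp add: d_def)
  have exp: "exp (- d * 2 ^ n) = q ^ 2 ^ n" for n
    using exp_of_nat_mult[of "2 ^ n" "ln q"] q by (simp add: d_def mult.commute)
  have bound: "N (F n - g) \<le> (\<bar>K\<bar> + 1) * exp (- d * 2 ^ n)" for n
  proof -
    have "K * q ^ 2 ^ n \<le> (\<bar>K\<bar> + 1) * q ^ 2 ^ n" by (rule mult_right_mono) (use q in auto)
    then show ?thesis using le[of n] unfolding exp by linarith
  qed
  have "(\<lambda>n. q ^ 2 ^ n) \<longlonglongrightarrow> 0"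
    using summable_rate[OF q] by (rule summable_LIMSEQ_zero)
  then have lim: "(\<lambda>n. K * q ^ 2 ^ n) \<longlonglongrightarrow> 0"
    using tendsto_mult_left[of "\<lambda>n. q ^ 2 ^ n" 0 sequentially K] by simp
  have "(\<lambda>n. N (F n - g)) \<longlonglongrightarrow> 0"
    by (rule tendsto_sandwich[OF always_eventually always_eventually tendsto_const lim])
      (use le N0 diff in auto)
  moreover have "\<exists>C>0. \<exists>D>0. \<forall>n. N (F n - g) \<le> C * exp (- D * 2 ^ n)"
    by (rule exI[of _ "\<bar>K\<bar> + 1"], rule conjI, simp, rule exI[of _ d]) (use d bound in blast)
  ultimately show ?thesis unfolding converges_quadratically_to_def by blast
qed

end

text \<open>The bracket of two squares is \<open>2 * cross a b\<close> times
  \<open>lform a * lform b\<close>, and \<open>Delta\<close> of three squares is twice the product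
  of the three crosses. The ratio 8 : 2 explains the 4 in \<open>H\<close>, which thus fixes
  products of three squares.\<close>

lemma bracket_squares:
  fixes a b c :: hvec
  defines "A \<equiv> lform a * lform a" and "B \<equiv> lform b * lform b" and "C \<equiv> lform c * lform c"
  shows "bracket B C * bracket C A * bracket A B = smult (4 * Delta A B C) (A * B * C)"
proof -
  have br: "bracket (lform u * lform u) (lform v * lform v) = smult (2 * cross u v) (lform u * lform v)" for u v
    unfolding bracket_lform smult_add_left[symmetric] by simp
  have "Delta A B C = 2 * (cross a b * cross b c * cross c a)"
    unfolding Delta_eq A_def B_def C_def lform_def
    by (simp add: cross_def numeral_2_eq_2 algebra_simps)
  then show ?thesis unfolding A_def B_def C_def br by (simp add: ac_simps)
qed

context three_discs
begin

lemma H_iterates_pconv: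
  assumes sub: "subordinate (F 0) discs" and step: "\<And>n. F (Suc n) = H discs (F n)"
  obtains \<theta> c l where "0 < \<theta>" "\<theta> < 1" "c \<noteq> 0" "\<And>j. norm (l j) < 1"
    "pconv \<theta> F (smult c (sextic (\<lambda>j. (l j, l j))))" "\<And>n. F n \<in> polys_upto 6"
proof -
  define P where "P n s \<longleftrightarrow> fst s \<noteq> 0 \<and> inside (snd s) \<and> F n = smult (fst s) (sextic (snd s))"
    for n and s :: "complex \<times> (3 \<Rightarrow> complex \<times> complex)"
  define Q where "Q s s' \<longleftrightarrow> (\<forall>j.
      (\<exists>\<nu>. norm \<nu> \<le> 1 \<and> harm (fst (snd s j)) (snd (snd s j)) \<nu> (fst (snd s' j))) \<and>
      (\<exists>\<nu>. norm \<nu> \<le> 1 \<and> harm (fst (snd s j)) (snd (snd s j)) \<nu> (snd (snd s' j))))"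
    for s s' :: "complex \<times> (3 \<Rightarrow> complex \<times> complex)"
  \<comment> \<open>\<open>H_sextic_step\<close> only asserts that suitable successors exist, so
    scalars and labelled roots are picked by dependent choice, with \<open>Q\<close> linking
    consecutive states.\<close>
  have "\<exists>s. \<forall>n. P n (s n) \<and> Q (s n) (s (Suc n))"
  proof (rule dependent_nat_choice)
    obtain c p where "c \<noteq> 0" "inside p" "F 0 = smult c (sextic p)"
      by (rule subordinate_sextic[OF sub])
    then show "\<exists>s. P 0 s" by (intro exI[of _ "(c, p)"]) (simp add: P_def)
  next
    fix s n assume "P n s"
    then have s: "fst s \<noteq> 0" "inside (snd s)" "F n = smult (fst s) (sextic (snd s))"
      by (auto simp: P_def)
    obtain c' p' where *: "c' \<noteq> 0" "inside p'" "H discs (smult (fst s) (sextic (snd s))) = smult c' (sextic p')"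
      "\<And>j. \<exists>\<nu>. norm \<nu> \<le> 1 \<and> harm (fst (snd s j)) (snd (snd s j)) \<nu> (fst (p' j))"
      "\<And>j. \<exists>\<nu>. norm \<nu> \<le> 1 \<and> harm (fst (snd s j)) (snd (snd s j)) \<nu> (snd (p' j))"
      using H_sextic_step[OF s(2,1)] by blast
    have "P (Suc n) (c', p')" using * s(3) step[of n] by (simp add: P_def)
    moreover have "Q s (c', p')" using *(4,5) by (simp add: Q_def)
    ultimately show "\<exists>s'. P (Suc n) s' \<and> Q s s'" by blast
  qed
  then obtain s where s: "\<And>n. P n (s n)" "\<And>n. Q (s n) (s (Suc n))" by blast
  define c where "c n = fst (s n)" for n
  define p where "p n = snd (s n)" for n
  have c: "c n \<noteq> 0" and p: "inside (p n)" and F: "F n = smult (c n) (sextic (p n))" for n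
    using s(1)[of n] by (auto simp: P_def c_def p_def)
  have st: "\<exists>\<nu>. norm \<nu> \<le> 1 \<and> harm (fst (p n j)) (snd (p n j)) \<nu> (fst (p (Suc n) j))"
    "\<exists>\<nu>. norm \<nu> \<le> 1 \<and> harm (fst (p n j)) (snd (p n j)) \<nu> (snd (p (Suc n) j))" for n j
    using s(2)[of n] unfolding Q_def p_def by blast+
  have ball: "norm (fst (p n j)) < 1" "norm (snd (p n j)) < 1" for n j
    using p[of n] by (auto simp: inside_def)
  define \<rho> where "\<rho> j = pseudo_hdist (fst (p 0 j)) (snd (p 0 j))" for j
  \<comment> \<open>One rate for all three discs; the entry \<open>1/2\<close> keeps it positive
    even if every pair coincides.\<close>
  define \<theta> where "\<theta> = max (1/2) (max (\<rho> 1) (max (\<rho> 2) (\<rho> 3)))"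
  have \<rho>: "\<rho> j < 1" for j unfolding \<rho>_def by (intro pseudo_hdist_less_1 ball)
  have \<theta>: "0 < \<theta>" "\<theta> < 1" using \<rho> by (auto simp: \<theta>_def)
  have \<rho>\<theta>: "\<rho> j \<le> \<theta>" for j using exhaust_3[of j] by (auto simp: \<theta>_def)
  have "\<exists>l. norm l < 1 \<and> qconv \<theta> (\<lambda>n. fst (p n j)) l \<and> qconv \<theta> (\<lambda>n. snd (p n j)) l" for j
    by (rule harm_sequence_qconv[of "\<lambda>n. fst (p n j)" "\<lambda>n. snd (p n j)" \<theta>,
          OF ball(1) ball(2) st(1) st(2) \<theta> \<rho>\<theta>[of j, unfolded \<rho>_def]]) blast
  then obtain l where l: "\<And>j. norm (l j) < 1" "\<And>j. qconv \<theta> (\<lambda>n. fst (p n j)) (l j)"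
    "\<And>j. qconv \<theta> (\<lambda>n. snd (p n j)) (l j)" by metis
  define l2 where "l2 j = (l j, l j)" for j
  have qc: "pconv \<theta> (\<lambda>n. q (p n) j) (q l2 j)" for j
    unfolding q_def l2_def fst_conv snd_conv by (rule pconv_qform[OF \<theta> l(2,3)])
  have sc: "pconv \<theta> (\<lambda>n. sextic (p n)) (sextic l2)"
    unfolding sextic_def by (intro pconv_mult[OF \<theta>] qc)
  define Br where "Br p = bracket (q p 2) (q p 3) * bracket (q p 3) (q p 1) * bracket (q p 1) (q p 2)" for p
  define De where "De p = Delta (q p 1) (q p 2) (q p 3)" for p
  have bc: "pconv \<theta> (\<lambda>n. Br (p n)) (Br l2)"
    unfolding Br_def by (intro pconv_mult[OF \<theta>] pconv_bracket[OF \<theta>] qc)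
  have dc: "qconv \<theta> (\<lambda>n. De (p n)) (De l2)"
    unfolding De_def by (intro qconv_Delta[OF \<theta>] qc)
  have D0: "De (p n) \<noteq> 0" for n unfolding De_def by (rule Delta_q_nonzero[OF p])
  have "inside l2" using l(1) by (simp add: inside_def l2_def)
  then have D2: "De l2 \<noteq> 0" unfolding De_def by (rule Delta_q_nonzero)
  have Br2: "Br l2 = smult (4 * De l2) (sextic l2)"
    unfolding Br_def De_def sextic_def unfolding q_def qform_def l2_def fst_conv snd_conv
    by (rule bracket_squares)
  text \<open>Comparing \<open>i\<close>-th coefficients in \<open>F (Suc n) = H discs (F n)\<close> isolates the quotient of the
    scalar factors.\<close>
  obtain i where i: "coeff (sextic l2) i \<noteq> 0"
    using sextic_nonzero[of l2] by (metis leading_coeff_0_iff)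
  have "qconv \<theta> (\<lambda>n. c (Suc n) / c n) 1"
  \<comment> \<open>Early iterates may have a vanishing \<open>i\<close>-th coefficient, so the
    formula for the quotient holds only eventually.\<close>
  proof (rule qconv_cong[OF \<theta>(1)])
    have "qconv \<theta> (\<lambda>n. coeff (sextic (p (Suc n))) i) (coeff (sextic l2) i)"
      by (rule qconv_Suc[OF \<theta> pconvD[OF sc]])
    then have "qconv \<theta> (\<lambda>n. coeff (Br (p n)) i / (4 * De (p n) * coeff (sextic (p (Suc n))) i))
        (coeff (Br l2) i / (4 * De l2 * coeff (sextic l2) i))"
      using D2 i by (intro qconv_divide[OF \<theta>] qconv_mult[OF \<theta>] qconv_const dc pconvD[OF bc]) auto
    \<comment> \<open>The limit is 1 because the limiting roots form three double points, for which
      \<open>bracket_squares\<close> applies.\<close>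
    moreover have "coeff (Br l2) i / (4 * De l2 * coeff (sextic l2) i) = 1"
      unfolding Br2 using D2 i by simp
    ultimately show "qconv \<theta> (\<lambda>n. coeff (Br (p n)) i / (4 * De (p n) * coeff (sextic (p (Suc n))) i)) 1"
      by simp
    have "\<forall>\<^sub>F n in sequentially. coeff (sextic (p (Suc n))) i \<noteq> 0"
      by (rule tendsto_imp_eventually_ne[OF qconv_tendsto[OF \<theta> qconv_Suc[OF \<theta> pconvD[OF sc]]] i])
    then show "\<forall>\<^sub>F n in sequentially.
        coeff (Br (p n)) i / (4 * De (p n) * coeff (sextic (p (Suc n))) i) = c (Suc n) / c n"
    proof eventually_elim
      case (elim n)
      have "smult (c (Suc n)) (sextic (p (Suc n))) = smult (c n / (4 * De (p n))) (Br (p n))"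
        using step[of n] unfolding F H_sextic[OF p c] De_def Br_def .
      then have "c (Suc n) * coeff (sextic (p (Suc n))) i = c n / (4 * De (p n)) * coeff (Br (p n)) i"
        by (metis coeff_smult)
      then show ?case using elim D0[of n] c[of n] by (simp add: field_simps)
    qed
  qed
  then obtain a where a: "a \<noteq> 0" "qconv \<theta> c a"
    by (rule qconv_of_quotients[OF \<theta> c])
  have "pconv \<theta> F (smult a (sextic l2))"
    unfolding F by (rule pconv_smult[OF \<theta> a(2) sc])
  moreover have "F n \<in> polys_upto 6" for n
    unfolding F polys_upto_def using degree_sextic[of "p n"] by (simp add: c)
  ultimately show thesis
    using \<theta> a(1) l(1) unfolding l2_def by (rule that[rotated -2])
qed

end

theorem theorem3p8:
  fixes f :: "complex poly" and D :: cp1_triple and F :: "nat \<Rightarrow> complex poly"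
  assumes "disjoint_open_discs D"
    and "admissible f"
    and "subordinate f D"
    and "F 0 = f"
    and "\<And>n. F (Suc n) = H D (F n)"
  shows "(\<forall>n. F n \<in> polys_upto 6) \<and>
    (\<exists>g\<in>polys_upto 6.
       (\<forall>N. norm_on_polys 6 N \<longrightarrow> converges_quadratically_to N F g) \<and>
       double_root_in_each g D)"
proof -
  obtain D1 D2 D3 where D: "D = (D1, D2, D3)" by (metis prod_cases3)
  have op: "open_disc D1" "open_disc D2" "open_disc D3" "D1 \<inter> D2 = {}" "D1 \<inter> D3 = {}" "D2 \<inter> D3 = {}"
    using assms(1) by (auto simp: disjoint_open_discs_def D)
  obtain M1 where M1: "mdet M1 \<noteq> 0" "D1 = mdisc M1" by (rule open_disc_mdisc[OF op(1)])
  obtain M2 where M2: "mdet M2 \<noteq> 0" "D2 = mdisc M2" by (rule open_disc_mdisc[OF op(2)])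
  obtain M3 where M3: "mdet M3 \<noteq> 0" "D3 = mdisc M3" by (rule open_disc_mdisc[OF op(3)])
  define M :: "3 \<Rightarrow> hvec \<times> hvec" where "M j = (if j = 1 then M1 else if j = 2 then M2 else M3)" for j
  have det: "mdet (M j) \<noteq> 0" for j using M1 M2 M3 by (simp add: M_def)
  interpret three_discs M
  proof
    show "mdet (M j) \<noteq> 0" for j by (rule det)
    show "mdisjoint (M i) (M j)" if "i \<noteq> j" for i j
    proof (rule mdisjoint_mdisc[OF det det])
      show "mdisc (M i) \<inter> mdisc (M j) = {}"
        using that exhaust_3[of i] exhaust_3[of j] op(4-6)[unfolded M1(2) M2(2) M3(2)]
        by (auto simp: M_def)
    qed
  qed
  have DM: "discs = D" by (simp add: discs_def D M_def M1(2) M2(2) M3(2))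
  obtain \<theta> c l where conv: "0 < \<theta>" "\<theta> < 1" "c \<noteq> 0" "\<And>j. norm (l j) < 1"
    "pconv \<theta> F (smult c (sextic (\<lambda>j. (l j, l j))))" "\<And>n. F n \<in> polys_upto 6"
    by (rule H_iterates_pconv[of F]) (use assms(3-5) in \<open>auto simp: DM\<close>)
  define g where "g = smult c (sextic (\<lambda>j. (l j, l j)))"
  have "g \<in> polys_upto 6" using degree_sextic conv(3) by (simp add: g_def polys_upto_def)
  moreover have "double_root_in_each g D"
    unfolding g_def DM[symmetric] by (rule double_root_sextic[OF conv(4,3)])
  moreover have "converges_quadratically_to N F g" if "norm_on_polys 6 N" for N
    using pconv_imp_converges_quadratically[OF conv(1,2) that conv(6) \<open>g \<in> polys_upto 6\<close>] conv(5)
    by (simp add: g_def)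
  ultimately show ?thesis using conv(6) by blast
qed

end
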